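(* Let $T$ be bounded with a positive bidiagonal factorization, let $\nu^{-\top}=\mathscr L\mathscr C$ with $\mathscr C\in\mathbb R^{p\times p}$ entrywise nonnegative and upper unitriangular, and let $\mathrm d\psi_1,\dots,\mathrm d\psi_p$ be the associated positive spectral measures. Let $N\ge p-1$. Then the following Gauss quadrature formulas hold: $$\int_\Delta x^n\,\mathrm d\psi_a(x)=\sum_{k=1}^{N+1}\mu^{[N]}_{k,a}\big(\lambda^{[N]}_k\big)^n,\qquad 0\le n\le d_a(N),\quad a\in\{1,\dots,p\}.$$ Moreover the degrees of precision $d_a(N)$ are optimal: for every $n>d_a(N)$ a positive remainder appears, i.e. $\int_\Delta x^n\,\mathrm d\psi_a(x)-\sum_{k=1}^{N+1}\mu^{[N]}_{k,a}(\lambda^{[N]}_k)^n>0$, and exactness is lost.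
   Context: Fix an integer $p\ge 1$; $\mathbb N_0=\{0,1,2,\dots\}$. $T=(T_{i,j})_{i,j\ge 0}$ is a real semi-infinite monic banded lower Hessenberg matrix: $T_{n,n+1}=1$ for all $n\ge0$, $T_{i,j}=0$ if $j>i+1$ or $j<i-p$, and $T_{n,n-p}\neq0$ for $n\ge p$. Bounded means $\|T\|_\infty=\sup_i\sum_j|T_{i,j}|<\infty$. $T^{[N]}=(T_{i,j})_{0\le i,j\le N}$. Type II recursion polynomials: $B_0=1$ and $B_{n+1}=(x-T_{n,n})B_n-T_{n,n-1}B_{n-1}-\cdots-T_{n,n-p}B_{n-p}$ (terms with negative index are $0$). Type I recursion polynomials: given a real lower unitriangular $p\times p$ matrix $\nu$, put $A^{(a)}_{j}=\nu_{j+1,a}$ for $0\le j\le p-1$, $A^{(a)}_{-1}=0$, and $A^{(a)}_{n-1}+T_{n,n}A^{(a)}_n+\cdots+T_{n+p,n}A^{(a)}_{n+p}=xA^{(a)}_n$, $n\in\mathbb N_0$, $a\in\{1,\dots,p\}$. Here $\nu^{-\top}=(\nu^{-1})^\top$. Positive bidiagonal factorization: $T=L_1\cdots L_pU$, where $L_k$ is lower bidiagonal with unit diagonal and $(L_k)_{j+1,j}=\alpha_{k+1+j(p+1)}$, $U$ is upper bidiagonal with unit superdiagonal and $U_{j,j}=\alpha_{1+j(p+1)}$ ($j\in\mathbb N_0$), and $\alpha_i>0$ for all $i\ge1$. The matrix $\mathscr L=[\mathscr L_1\ \cdots\ \mathscr L_p]\in\mathbb R^{p\times p}$ has columns $\mathscr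 L_1=(1,0,\dots,0)^\top$ and, for $2\le k\le p$, $\mathscr L_k=\frac1{d_k}L_1^{[p-1]}\cdots L_{k-1}^{[p-1]}(1,0,\dots,0)^\top$, $d_k=\alpha_k\alpha_{k+p}\alpha_{k+2p}\cdots\alpha_{k+(k-2)p}$, with $L_i^{[p-1]}$ the leading $p\times p$ principal submatrix of $L_i$. Under a positive bidiagonal factorization the zeros of $B_{N+1}$, which are the eigenvalues of $T^{[N]}$, are simple and positive: $\lambda^{[N]}_1>\cdots>\lambda^{[N]}_{N+1}>0$. $\Delta=[\xi,\eta]$, $\xi=\lim_N\lambda^{[N]}_{N+1}$, $\eta=\lim_N\lambda_1^{[N]}$. The spectral measures $\mathrm d\psi_1,\dots,\mathrm d\psi_p$ are positive Lebesgue--Stieltjes measures supported in $\Delta$ with $\int_\Delta\sum_{a=1}^pA^{(a)}_k(x)B_l(x)\,\mathrm d\psi_a(x)=\delta_{k,l}$ for all $k,l\in\mathbb N_0$. Christoffel numbers: let $\mathscr U=(B_{i-1}(\lambda^{[N]}_j))_{1\le i,j\le N+1}$, $\mathscr W=\mathscr U^{-1}=(w_{k,n})$ (its rows are the left eigenvectors of $T^{[N]}$ biorthogonal to the right eigenvectors $(B_0(\lambda_k^{[N]}),\dots,B_N(\lambda_k^{[N]}))^\top$), and $(\mu^{[N]}_{k,1},\dots,\mu^{[N]}_{k,p})^\top=\nu^{-1}(w_{k,1},\dots,w_{k,p})^\top$. $e_1$ is the first canonical vector, and $e_a^\nu$ is the vector $\nu^{-\top}e_a\in\mathbb R^p$ ($e_a$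 canonical in $\mathbb R^p$) extended by zeros (to length $N+1$, or to a semi-infinite vector). The degree of precision $d_a(N)$ is the largest natural number such that $e_1^\top T^ne_a^\nu=e_1^\top(T^{[N]})^ne_a^\nu$ for all $0\le n\le d_a(N)$. *)

theory Defs
  imports
    "HOL-Analysis.Analysis"
    "HOL-Computational_Algebra.Polynomial"
    "Jordan_Normal_Form.Gauss_Jordan_Elimination"
begin

(* Finite vectors and matrices are those of Jordan_Normal_Form, whose indices start at 0; the
   indices k, a, N of the mathematical text keep their original ranges, so that for instance the
   component "a" with 1 <= a <= p of a vector sits at position a - 1. *)
unbundle no vec_syntax and no inner_syntax
hide_const (open) Finite_Cartesian_Product.vec Finite_Cartesian_Product.mat
hide_type (open) Finite_Cartesian_Product.vec

type_synonym si_matrix = "nat \<Rightarrow> nat \<Rightarrow> real"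

text \<open>Sums over the support of a row: only meaningful for row-finite matrices, which covers all
  banded and lower Hessenberg ones.\<close>

definition si_mult :: "si_matrix \<Rightarrow> si_matrix \<Rightarrow> si_matrix" where
  "si_mult A B = (\<lambda>i j. \<Sum>k | A i k \<noteq> 0. A i k * B k j)"

definition si_one :: si_matrix where
  "si_one = (\<lambda>i j. if i = j then 1 else 0)"

primrec si_power :: "si_matrix \<Rightarrow> nat \<Rightarrow> si_matrix" where
  "si_power A 0 = si_one"
| "si_power A (Suc n) = si_mult (si_power A n) A"

definition si_bounded :: "si_matrix \<Rightarrow> bool" where
  "si_bounded A \<longleftrightarrow> bdd_above (range (\<lambda>i. \<Sum>j | A i j \<noteq> 0. \<bar>A i j\<bar>))"

text \<open>The truncation \<open>A\<^sup>[\<^sup>N\<^sup>]\<close> has size \<open>N + 1\<close>.\<close>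

definition si_trunc :: "si_matrix \<Rightarrow> nat \<Rightarrow> real mat" where
  "si_trunc A N = mat (N + 1) (N + 1) (\<lambda>(i, j). A i j)"

definition banded_monic_hessenberg :: "nat \<Rightarrow> si_matrix \<Rightarrow> bool" where
  "banded_monic_hessenberg p T \<longleftrightarrow>
     (\<forall>n. T n (n + 1) = 1) \<and>
     (\<forall>i j. j > i + 1 \<or> j + p < i \<longrightarrow> T i j = 0) \<and>
     (\<forall>n\<ge>p. T n (n - p) \<noteq> 0)"

definition L_factor :: "nat \<Rightarrow> (nat \<Rightarrow> real) \<Rightarrow> nat \<Rightarrow> si_matrix" where
  "L_factor p \<alpha> k = (\<lambda>i j.
     if i = j then 1 else if i = j + 1 then \<alpha> (k + 1 + j * (p + 1)) else 0)"

definition U_factor :: "nat \<Rightarrow> (nat \<Rightarrow> real) \<Rightarrow> si_matrix" where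
  "U_factor p \<alpha> = (\<lambda>i j.
     if j = i then \<alpha> (1 + j * (p + 1)) else if j = i + 1 then 1 else 0)"

text \<open>\<open>T = L\<^sub>1 (L\<^sub>2 (\<dots> (L\<^sub>p U)))\<close>; the value \<open>\<alpha> 0\<close> plays no role.\<close>

definition positive_bidiagonal_factorization ::
    "nat \<Rightarrow> (nat \<Rightarrow> real) \<Rightarrow> si_matrix \<Rightarrow> bool" where
  "positive_bidiagonal_factorization p \<alpha> T \<longleftrightarrow>
     (\<forall>i\<ge>1. \<alpha> i > 0) \<and>
     T = foldr (\<lambda>k. si_mult (L_factor p \<alpha> k)) [1..<p + 1] (U_factor p \<alpha>)"

text \<open>Column \<open>k\<close> is \<open>L\<^sub>1 (L\<^sub>2 (\<dots> (L\<^bsub>k-1\<^esub> e\<^sub>1))) / d\<^sub>k\<close> with \<open>p \<times> p\<close> truncations of the factors; for \<open>k = 1\<close>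
  both products are empty, which gives the first column \<open>e\<^sub>1\<close>.\<close>

definition script_d :: "nat \<Rightarrow> (nat \<Rightarrow> real) \<Rightarrow> nat \<Rightarrow> real" where
  "script_d p \<alpha> k = (\<Prod>i<k - 1. \<alpha> (k + i * p))"

definition script_L_col :: "nat \<Rightarrow> (nat \<Rightarrow> real) \<Rightarrow> nat \<Rightarrow> real vec" where
  "script_L_col p \<alpha> k = (1 / script_d p \<alpha> k) \<cdot>\<^sub>v
     foldr (\<lambda>i v. si_trunc (L_factor p \<alpha> i) (p - 1) *\<^sub>v v) [1..<k] (unit_vec p 0)"

definition script_L :: "nat \<Rightarrow> (nat \<Rightarrow> real) \<Rightarrow> real mat" where
  "script_L p \<alpha> = mat_of_cols p (map (script_L_col p \<alpha>) [1..<p + 1])"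

definition upper_unitriangular :: "real mat \<Rightarrow> bool" where
  "upper_unitriangular A \<longleftrightarrow>
     square_mat A \<and> upper_triangular A \<and> (\<forall>i<dim_row A. A $$ (i, i) = 1)"

definition lower_unitriangular :: "real mat \<Rightarrow> bool" where
  "lower_unitriangular A \<longleftrightarrow> upper_unitriangular (transpose_mat A)"

definition mat_inv :: "real mat \<Rightarrow> real mat" where
  "mat_inv A = the (mat_inverse A)"

text \<open>Type II recursion polynomials. By truncated subtraction, \<open>{n - p..n}\<close> leaves out exactly the
  terms of negative index.\<close>

function typeII :: "nat \<Rightarrow> si_matrix \<Rightarrow> nat \<Rightarrow> real poly" where
  "typeII p T 0 = 1"
| "typeII p T (Suc n) = [:0, 1:] * typeII p T n - (\<Sum>i\<in>{n - p..n}. Polynomial.smult (T n i) (typeII p T i))"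
  by pat_completeness auto
termination by (relation "Wellfounded.measure (\<lambda>(p, T, n). n)") auto

text \<open>Type I recursion polynomials \<open>A\<^sub>n\<^sup>(\<^sup>a\<^sup>)\<close>, the recursion being solved for the term of highest
  index (see \<open>typeI_recursion\<close> below).\<close>

function typeI :: "nat \<Rightarrow> si_matrix \<Rightarrow> real mat \<Rightarrow> nat \<Rightarrow> nat \<Rightarrow> real poly" where
  "typeI p T \<nu> a n =
     (if n < p then [:\<nu> $$ (n, a - 1):]
      else if p = 0 then 0
      else Polynomial.smult (1 / T n (n - p))
        ([:0, 1:] * typeI p T \<nu> a (n - p)
         - (if n = p then 0 else typeI p T \<nu> a (n - p - 1))
         - (\<Sum>i<p. Polynomial.smult (T (n - p + i) (n - p)) (typeI p T \<nu> a (n - p + i)))))"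
  by pat_completeness auto
termination by (relation "Wellfounded.measure (\<lambda>(p, T, \<nu>, a, n). n)") auto

declare typeI.simps [simp del]

lemma typeI_initial: "j < p \<Longrightarrow> typeI p T \<nu> a j = [:\<nu> $$ (j, a - 1):]"
  by (simp add: typeI.simps)

lemma typeI_recursion:
  assumes "p \<ge> 1" "banded_monic_hessenberg p T"
  shows "(if n = 0 then 0 else typeI p T \<nu> a (n - 1))
           + (\<Sum>i\<le>p. Polynomial.smult (T (n + i) n) (typeI p T \<nu> a (n + i)))
         = [:0, 1:] * typeI p T \<nu> a n"
proof -
  have "T (n + p) n \<noteq> 0"
    using assms(2) unfolding banded_monic_hessenberg_def by (metis add_diff_cancel_right' le_add2)
  then have "Polynomial.smult (T (n + p) n) (typeI p T \<nu> a (n + p)) =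
      [:0, 1:] * typeI p T \<nu> a n - (if n = 0 then 0 else typeI p T \<nu> a (n - 1))
      - (\<Sum>i<p. Polynomial.smult (T (n + i) n) (typeI p T \<nu> a (n + i)))"
    using assms(1) by (subst typeI.simps[of p T \<nu> a "n + p"]) (auto simp: Polynomial.smult_diff_right)
  then show ?thesis
    by (simp add: lessThan_Suc_atMost[symmetric] del: mult_pCons_left)
qed

text \<open>The zeros \<open>\<lambda>\<^sub>1 > \<dots> > \<lambda>\<^bsub>N+1\<^esub>\<close> of \<open>B\<^bsub>N+1\<^esub>\<close> in decreasing order.\<close>

definition zeroB :: "nat \<Rightarrow> si_matrix \<Rightarrow> nat \<Rightarrow> nat \<Rightarrow> real" where
  "zeroB p T N k = rev (sorted_list_of_set {x. poly (typeII p T (N + 1)) x = 0}) ! (k - 1)"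

definition Delta :: "nat \<Rightarrow> si_matrix \<Rightarrow> real set" where
  "Delta p T = {lim (\<lambda>N. zeroB p T N (N + 1))..lim (\<lambda>N. zeroB p T N 1)}"

text \<open>The measure \<open>d\<psi>\<^sub>a\<close> is the Lebesgue--Stieltjes measure of a nondecreasing function \<open>\<psi>\<^sub>a\<close>,
  normalized to be right-continuous. Being concentrated on a compact interval, it is finite.\<close>

definition spectral_measures ::
    "nat \<Rightarrow> si_matrix \<Rightarrow> real mat \<Rightarrow> (nat \<Rightarrow> real \<Rightarrow> real) \<Rightarrow> bool" where
  "spectral_measures p T \<nu> \<psi> \<longleftrightarrow>
     (\<forall>a\<in>{1..p}. mono (\<psi> a) \<and> (\<forall>x. continuous (at_right x) (\<psi> a)) \<and>
        emeasure (interval_measure (\<psi> a)) (UNIV - Delta p T) = 0) \<and>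
     (\<forall>k l. (\<Sum>a\<in>{1..p}. LINT x:Delta p T|interval_measure (\<psi> a).
                poly (typeI p T \<nu> a k) x * poly (typeII p T l) x)
            = (if k = l then 1 else 0))"

definition script_U :: "nat \<Rightarrow> si_matrix \<Rightarrow> nat \<Rightarrow> real mat" where
  "script_U p T N = mat (N + 1) (N + 1) (\<lambda>(i, j). poly (typeII p T i) (zeroB p T N (j + 1)))"

definition script_W :: "nat \<Rightarrow> si_matrix \<Rightarrow> nat \<Rightarrow> real mat" where
  "script_W p T N = mat_inv (script_U p T N)"

definition christoffel_number :: "nat \<Rightarrow> si_matrix \<Rightarrow> real mat \<Rightarrow> nat \<Rightarrow> nat \<Rightarrow> nat \<Rightarrow> real" where
  "christoffel_number p T \<nu> N k a =
     (mat_inv \<nu> *\<^sub>v vec p (\<lambda>i. script_W p T N $$ (k - 1, i))) $ (a - 1)"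

text \<open>The components of \<open>e\<^sub>a\<^sup>\<nu> = \<nu>\<^sup>-\<^sup>\<top> e\<^sub>a\<close>, extended by zeros to a semi-infinite vector.\<close>

definition e_nu :: "nat \<Rightarrow> real mat \<Rightarrow> nat \<Rightarrow> nat \<Rightarrow> real" where
  "e_nu p \<nu> a = (\<lambda>i.
     if i < p then (transpose_mat (mat_inv \<nu>) *\<^sub>v unit_vec p (a - 1)) $ i else 0)"

definition moment_inf :: "nat \<Rightarrow> si_matrix \<Rightarrow> real mat \<Rightarrow> nat \<Rightarrow> nat \<Rightarrow> real" where
  "moment_inf p T \<nu> a n = (\<Sum>j | e_nu p \<nu> a j \<noteq> 0. si_power T n 0 j * e_nu p \<nu> a j)"

definition moment_trunc :: "nat \<Rightarrow> si_matrix \<Rightarrow> real mat \<Rightarrow> nat \<Rightarrow> nat \<Rightarrow> nat \<Rightarrow> real" where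
  "moment_trunc p T \<nu> N a n =
     unit_vec (N + 1) 0 \<bullet> ((si_trunc T N ^\<^sub>m n) *\<^sub>v vec (N + 1) (e_nu p \<nu> a))"

definition degree_of_precision :: "nat \<Rightarrow> si_matrix \<Rightarrow> real mat \<Rightarrow> nat \<Rightarrow> nat \<Rightarrow> nat" where
  "degree_of_precision p T \<nu> N a =
     (GREATEST d. \<forall>n\<le>d. moment_inf p T \<nu> a n = moment_trunc p T \<nu> N a n)"

end

theory Submission
  imports Defs "Jordan_Normal_Form.Determinant"
begin

text \<open>Both sides of the quadrature formula are moments of matrices, and their difference counts walks.

  \<^item> The integral of \<open>x\<^sup>n\<close> against the \<open>a\<close>-th measure is \<open>e\<^sub>1\<^sup>T T\<^sup>n e\<^sub>a\<^sup>\<nu>\<close>: expand \<open>x\<^sup>n\<close> in the type II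
    polynomials by means of \<open>T B = x B\<close> and integrate with the first \<open>p\<close> rows of the biorthogonality
    relations (\<open>moment_inf_eq_integral\<close>).

  \<^item> The quadrature sum is the same expression for the truncation \<open>T\<^sup>[\<^sup>N\<^sup>]\<close>, by the spectral decomposition
    of \<open>T\<^sup>[\<^sup>N\<^sup>]\<close> (\<open>quadrature_sum_eq_moment_trunc\<close>). This needs \<open>B\<^bsub>N+1\<^esub>\<close> to have \<open>N + 1\<close> distinct real
    zeros.

  \<^item> The entries of \<open>T\<close> are nonnegative, and so are those of \<open>e\<^sub>a\<^sup>\<nu>\<close>, the \<open>a\<close>-th column of a product of two
    nonnegative matrices. The difference of the two moments is therefore a sum of nonnegative weights
    of walks of length \<open>n\<close> that start at \<open>0\<close>, leave \<open>{0..N}\<close>, and return to the support of \<open>e\<^sub>a\<^sup>\<nu>\<close>. Such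
    walks exist for some length since the entries of \<open>T\<close> next to the diagonal are positive, and with
    every length \<open>n\<close> also for the length \<open>n + 1\<close> since the diagonal is positive. There is none of length
    \<open>0\<close>. So the remainder vanishes up to some \<open>n\<close> and is positive from there on, and by definition the
    change happens at the degree of precision (\<open>degree_of_precision_split\<close>).

  The simplicity and positivity of the zeros come from the bidiagonal factors. They refine the sequence
  \<open>B\<^sub>n\<close> to a chain \<open>P\<^sub>m\<close> with \<open>B\<^sub>n = P\<^bsub>(p+1)n\<^esub>\<close> and
  \<open>P\<^bsub>m+p+1\<^esub> = w P\<^bsub>m+p\<^esub> - \<alpha>\<^bsub>m+1\<^esub> P\<^sub>m\<close>, where \<open>w\<close> is \<open>x\<close> or \<open>1\<close>. In this recurrence the two terms
  never have opposite signs at the zeros of the intermediate members, so interlacing propagates along the chain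
  (\<open>chain_interlaced\<close>).\<close>

section \<open>Interlacing of positive simple zeros\<close>

text \<open>Indexing the zeros from the largest one downwards is the order in which the eigenvalues
  \<open>\<lambda>\<^sub>1 > \<lambda>\<^sub>2 > \<dots>\<close> are numbered. It also gives interlacing the same inequalities whether the two
  degrees agree or differ by one.\<close>

definition desc_zero :: "real poly \<Rightarrow> nat \<Rightarrow> real" where
  "desc_zero f r = rev (sorted_list_of_set {x. poly f x = 0}) ! r"

lemma desc_zero_eqI:
  assumes decr: "\<And>r s. r < s \<Longrightarrow> s < d \<Longrightarrow> y s < y r"
    and zeros: "{x. poly f x = 0} = y ` {..<d}" and "r < d"
  shows "desc_zero f r = y r"
proof -
  define ys where "ys = rev (map y [0..<d])"
  have "sorted_wrt (<) ys"
    unfolding ys_def using decr by (auto simp: sorted_wrt_iff_nth_less rev_nth)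
  then have "sorted ys" "distinct ys"
    by (auto simp: strict_sorted_iff)
  moreover have "set ys = {x. poly f x = 0}"
    by (simp add: ys_def zeros atLeast0LessThan)
  ultimately have "sorted_list_of_set {x. poly f x = 0} = ys"
    by (metis sorted_list_of_set.idem_if_sorted_distinct)
  then show ?thesis
    using \<open>r < d\<close> by (simp add: desc_zero_def ys_def)
qed

lemma monic_eq_prod_zeros:
  fixes f :: "real poly"
  assumes "lead_coeff f = 1" "inj_on y {..<degree f}" "\<And>r. r < degree f \<Longrightarrow> poly f (y r) = 0"
  shows "f = (\<Prod>r<degree f. [:- y r, 1:])"
proof (rule ccontr)
  define g where "g = (\<Prod>r<degree f. [:- y r, 1:])"
  assume "f \<noteq> (\<Prod>r<degree f. [:- y r, 1:])"
  then have ne: "f - g \<noteq> 0" by (simp add: g_def)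
  have dg: "degree g = degree f"
    unfolding g_def by (subst degree_prod_eq_sum_degree) auto
  have lg: "lead_coeff g = 1"
    unfolding g_def by (simp add: lead_coeff_prod)
  have "degree f \<noteq> 0"
  proof
    assume d0: "degree f = 0"
    then have "g = 1" by (simp add: g_def)
    moreover have "f = 1" using d0 assms(1) by (metis coeff_pCons_0 degree_eq_zeroE one_pCons)
    ultimately show False using ne by simp
  qed
  moreover have "coeff (f - g) (degree f) = 0"
    using assms(1) lg dg by simp
  moreover have "degree (f - g) \<le> degree f"
    using dg by (metis degree_diff_le order_refl)
  ultimately have "degree (f - g) < degree f"
    using ne by (metis leading_coeff_0_iff order_le_less)
  moreover have "y ` {..<degree f} \<subseteq> {x. poly (f - g) x = 0}"
    using assms(3) by (auto simp: g_def poly_prod intro!: prod_zero)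
  then have "card (y ` {..<degree f}) \<le> card {x. poly (f - g) x = 0}"
    by (intro card_mono poly_roots_finite ne)
  then have "degree f \<le> card {x. poly (f - g) x = 0}"
    by (simp add: card_image[OF assms(2)])
  moreover have "card {x. poly (f - g) x = 0} \<le> degree (f - g)"
    using ne by (rule card_poly_roots_bound)
  ultimately show False by simp
qed

definition pos_simple_zeros :: "real poly \<Rightarrow> bool" where
  "pos_simple_zeros f \<longleftrightarrow>
     f = (\<Prod>r<degree f. [:- desc_zero f r, 1:]) \<and>
     (\<forall>r s. r < s \<and> s < degree f \<longrightarrow> desc_zero f s < desc_zero f r) \<and>
     (\<forall>r<degree f. 0 < desc_zero f r)"

text \<open>The intermediate value theorem puts a zero of \<open>f\<close> in each of the \<open>degree f\<close> gaps between
  consecutive points \<open>q\<close>; by their number these are all zeros of \<open>f\<close>, so the \<open>r\<close>-th largest one lies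
  in the \<open>r\<close>-th gap.\<close>

lemma zeros_between_alternating_signs:
  fixes f :: "real poly"
  assumes lc: "lead_coeff f = 1"
    and q: "\<And>r. r < degree f \<Longrightarrow> q (Suc r) < q r" "0 \<le> q (degree f)"
    and sgn: "\<And>r. r \<le> degree f \<Longrightarrow> 0 < (-1) ^ r * poly f (q r)"
  shows "pos_simple_zeros f"
    and "r < degree f \<Longrightarrow> q (Suc r) < desc_zero f r \<and> desc_zero f r < q r"
proof -
  let ?d = "degree f"
  have "\<exists>x. q (Suc r) < x \<and> x < q r \<and> poly f x = 0" if "r < ?d" for r
  proof -
    have a: "0 < (-1) ^ r * poly f (q r)" "0 < (-1) ^ Suc r * poly f (q (Suc r))"
      using sgn[of r] sgn[of "Suc r"] that by auto
    have "poly f (q (Suc r)) * poly f (q r) < 0"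
    proof (cases "even r")
      case True
      then show ?thesis using a by (auto simp: mult_less_0_iff)
    next
      case False
      then show ?thesis using a by (auto simp: mult_less_0_iff)
    qed
    then show ?thesis using poly_IVT[OF q(1)[OF that]] by blast
  qed
  then obtain y where y: "\<And>r. r < ?d \<Longrightarrow> q (Suc r) < y r \<and> y r < q r \<and> poly f (y r) = 0"
    by metis
  have qmono: "q s \<le> q r" if "r \<le> s" "s \<le> ?d" for r s
    using that(1,2)
  proof (induction s rule: dec_induct)
    case (step s)
    then show ?case using q(1)[of s] by simp
  qed simp
  have ydec: "y s < y r" if "r < s" "s < ?d" for r s
    using y[of r] y[of s] qmono[of "Suc r" s] that by simp
  then have inj: "inj_on y {..<?d}"
    by (metis inj_onI lessThan_iff less_irrefl linorder_neqE_nat)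
  have prod: "f = (\<Prod>r<?d. [:- y r, 1:])"
    using monic_eq_prod_zeros[OF lc inj] y by blast
  have "{x. poly f x = 0} = y ` {..<?d}"
    by (subst prod) (auto simp: poly_prod)
  then have eq: "desc_zero f r = y r" if "r < ?d" for r
    using ydec that by (intro desc_zero_eqI[of ?d y f]) auto
  have "0 < y r" if "r < ?d" for r
    using y[OF that] qmono[of "Suc r" ?d] q(2) that by simp
  moreover have "(\<Prod>r<?d. [:- y r, 1:]) = (\<Prod>r<?d. [:- desc_zero f r, 1:])"
    by (intro prod.cong) (auto simp: eq)
  ultimately show "pos_simple_zeros f"
    using prod ydec eq by (simp add: pos_simple_zeros_def)
  show "q (Suc r) < desc_zero f r \<and> desc_zero f r < q r" if "r < ?d" for r
    using y[OF that] eq[OF that] by simp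
qed

text \<open>Each zero beyond \<open>x\<close> contributes one negative factor to the monic product.\<close>

lemma sign_by_counting_larger_zeros:
  assumes f: "pos_simple_zeros f" and "c \<le> degree f"
    and larger: "\<And>s. s < c \<Longrightarrow> x < desc_zero f s"
    and smaller: "\<And>s. c \<le> s \<Longrightarrow> s < degree f \<Longrightarrow> desc_zero f s < x"
  shows "0 < (-1) ^ c * poly f x"
proof -
  have "poly f x = poly (\<Prod>r<degree f. [:- desc_zero f r, 1:]) x"
    using f unfolding pos_simple_zeros_def by metis
  also have "\<dots> = (\<Prod>r<degree f. x - desc_zero f r)"
    by (simp add: poly_prod)
  also have "\<dots> = (\<Prod>r<c. x - desc_zero f r) * (\<Prod>r\<in>{c..<degree f}. x - desc_zero f r)"
    using \<open>c \<le> degree f\<close> by (subst prod.union_disjoint[symmetric]) (auto intro!: prod.cong)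
  finally have "(-1) ^ c * poly f x =
      ((-1) ^ c * (\<Prod>r<c. x - desc_zero f r)) * (\<Prod>r\<in>{c..<degree f}. x - desc_zero f r)"
    by simp
  also have "(-1) ^ c * (\<Prod>r<c. x - desc_zero f r) = (\<Prod>r<c. desc_zero f r - x)"
    by (induction c) (simp_all add: algebra_simps)
  finally show ?thesis
    using larger smaller by (auto intro!: mult_pos_pos prod_pos)
qed

lemma desc_zero_is_zero:
  assumes "pos_simple_zeros f" "r < degree f"
  shows "poly f (desc_zero f r) = 0"
proof -
  have "poly f (desc_zero f r) = poly (\<Prod>s<degree f. [:- desc_zero f s, 1:]) (desc_zero f r)"
    using assms(1) unfolding pos_simple_zeros_def by metis
  also have "\<dots> = 0"
    using assms(2) by (auto simp: poly_prod intro!: prod_zero)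
  finally show ?thesis .
qed

text \<open>The zeros of \<open>f\<close> and \<open>g\<close> alternate and the largest one of all belongs to \<open>g\<close>: with \<open>y\<close> and \<open>z\<close>
  the decreasing zeros of \<open>f\<close> and \<open>g\<close>, this is \<open>z\<^sub>0 > y\<^sub>0 > z\<^sub>1 > y\<^sub>1 > \<dots>\<close>, which ends with a zero of
  \<open>f\<close> if the degrees agree and with a zero of \<open>g\<close> otherwise.\<close>

definition interlaced :: "real poly \<Rightarrow> real poly \<Rightarrow> bool" where
  "interlaced f g \<longleftrightarrow> pos_simple_zeros f \<and> pos_simple_zeros g \<and>
     degree f \<le> degree g \<and> degree g \<le> degree f + 1 \<and>
     (\<forall>r<degree f. desc_zero f r < desc_zero g r) \<and>
     (\<forall>r. r + 1 < degree g \<longrightarrow> desc_zero g (r + 1) < desc_zero f r)"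

lemma desc_zero_antimono:
  "pos_simple_zeros f \<Longrightarrow> r \<le> s \<Longrightarrow> s < degree f \<Longrightarrow> desc_zero f s \<le> desc_zero f r"
  unfolding pos_simple_zeros_def by (metis order_le_less)

text \<open>The next two lemmas translate interlacing into signs, in which form it passes through a linear
  recurrence.\<close>

lemma interlaced_sign_right_at_left:
  assumes fg: "interlaced f g" and r: "r < degree f"
  shows "0 < (-1) ^ Suc r * poly g (desc_zero f r)"
proof (rule sign_by_counting_larger_zeros)
  show "pos_simple_zeros g" "Suc r \<le> degree g"
    using assms by (auto simp: interlaced_def)
  show "desc_zero f r < desc_zero g s" if "s < Suc r" for s
    using assms that desc_zero_antimono[of g s r] by (fastforce simp: interlaced_def)
  show "desc_zero g s < desc_zero f r" if "Suc r \<le> s" "s < degree g" for s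
  proof -
    have "desc_zero g s \<le> desc_zero g (Suc r)"
      using fg that by (intro desc_zero_antimono) (simp_all add: interlaced_def)
    also have "\<dots> < desc_zero f r"
      using fg that by (simp add: interlaced_def)
    finally show ?thesis .
  qed
qed

lemma interlaced_sign_left_at_right:
  assumes fg: "interlaced f g" and r: "r < degree g"
  shows "0 < (-1) ^ r * poly f (desc_zero g r)"
proof (rule sign_by_counting_larger_zeros)
  show "pos_simple_zeros f" "r \<le> degree f"
    using assms by (auto simp: interlaced_def)
  show "desc_zero g r < desc_zero f s" if "s < r" for s
  proof -
    have "desc_zero g r \<le> desc_zero g (Suc s)"
      using fg r that by (intro desc_zero_antimono) (simp_all add: interlaced_def)
    also have "\<dots> < desc_zero f s"
      using fg r that by (simp add: interlaced_def)
    finally show ?thesis .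
  qed
  show "desc_zero f s < desc_zero g r" if "r \<le> s" "s < degree f" for s
  proof -
    have "desc_zero f s \<le> desc_zero f r"
      using fg that by (intro desc_zero_antimono) (simp_all add: interlaced_def)
    also have "\<dots> < desc_zero g r"
      using fg that by (simp add: interlaced_def)
    finally show ?thesis .
  qed
qed

text \<open>Conversely, alternating signs of \<open>h\<close> at the zeros of \<open>f\<close> force interlacing. Two further signs
  supply the zeros at the ends: \<open>h\<close> is positive far to the right, and if \<open>h\<close> has the larger degree
  its sign at \<open>0\<close> produces one more zero between \<open>0\<close> and the smallest zero of \<open>f\<close>.\<close>

lemma interlacedI:
  assumes f: "pos_simple_zeros f" and lc: "lead_coeff h = 1"
    and deg: "degree f \<le> degree h" "degree h \<le> degree f + 1"
    and sgn: "\<And>r. r < degree f \<Longrightarrow> 0 < (-1) ^ Suc r * poly h (desc_zero f r)"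
    and sgn0: "0 < (-1) ^ degree h * poly h 0"
  shows "interlaced f h"
proof -
  obtain M0 where M0: "\<And>x. M0 \<le> x \<Longrightarrow> 1 \<le> poly h x"
    using poly_pinfty_gt_lc[of h] lc by auto
  define M where "M = max M0 (max 1 (desc_zero f 0 + 1))"
  have M: "0 < poly h M" "0 < M" "desc_zero f 0 < M"
    using M0[of M] by (auto simp: M_def)
  \<comment> \<open>The test points: a point to the right of everything, then the zeros of \<open>f\<close>, then \<open>0\<close>. If the
     degrees agree, the point \<open>0\<close> comes one step too late to be tested.\<close>
  define q where "q r = (case r of 0 \<Rightarrow> M | Suc s \<Rightarrow> if s < degree f then desc_zero f s else 0)" for r
  have dec: "q (Suc r) < q r" if "r < degree h" for r
    using f that deg M by (auto simp: q_def pos_simple_zeros_def split: nat.split)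
  have nonneg: "0 \<le> q (degree h)"
    using f M by (auto simp: q_def pos_simple_zeros_def less_imp_le split: nat.split)
  have alt: "0 < (-1) ^ r * poly h (q r)" if "r \<le> degree h" for r
  proof (cases r)
    case 0
    then show ?thesis using M by (simp add: q_def)
  next
    case (Suc s)
    show ?thesis
    proof (cases "s < degree f")
      case True
      then show ?thesis using sgn[of s] Suc by (simp add: q_def)
    next
      case False
      then have "r = degree h" using Suc that deg by simp
      moreover have "q (Suc s) = 0" using False by (simp add: q_def)
      ultimately show ?thesis using sgn0 Suc by simp
    qed
  qed
  note * = zeros_between_alternating_signs[where q = q, OF lc dec nonneg alt]
  have "desc_zero f r < desc_zero h r" if "r < degree f" for r
    using *(2)[of r] that deg by (simp add: q_def)
  moreover have "desc_zero h (r + 1) < desc_zero f r" if "r + 1 < degree h" for r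
    using *(2)[of "r + 1"] that deg by (simp add: q_def split: if_splits)
  ultimately show ?thesis
    using f *(1) deg by (simp add: interlaced_def)
qed

section \<open>The Darboux chain of polynomials\<close>

text \<open>Splitting \<open>T = L\<^sub>1 \<dots> L\<^sub>p U\<close> into its factors inserts \<open>p\<close> families of polynomials between \<open>B\<^sub>n\<close> and
  \<open>B\<^bsub>n+1\<^esub>\<close>. Writing \<open>F\<^sub>k = (P\<^bsub>(p+1)n+k\<^esub>)\<^sub>n\<close> for the subsequences of the sequence \<open>P\<close> below, its recurrence
  says \<open>U F\<^sub>0 = x F\<^sub>p\<close> and \<open>L\<^sub>k F\<^sub>k = F\<^bsub>k-1\<^esub>\<close>, so that \<open>T F\<^sub>0 = x F\<^sub>0\<close> and \<open>F\<^sub>0\<close> is the sequence of the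
  \<open>B\<^sub>n\<close>. Passing from \<open>F\<^sub>k\<close> to \<open>F\<^bsub>k+1\<^esub>\<close> is a Darboux transformation. The gain is a recurrence with two
  terms only, whose coefficients have fixed signs.\<close>

fun darboux_chain :: "nat \<Rightarrow> (nat \<Rightarrow> real) \<Rightarrow> nat \<Rightarrow> real poly" where
  "darboux_chain p \<alpha> m =
     (if m \<le> p then 1
      else (if (p + 1) dvd m then [:0, 1:] else 1) * darboux_chain p \<alpha> (m - 1)
             - Polynomial.smult (\<alpha> (m - p)) (darboux_chain p \<alpha> (m - p - 1)))"

declare darboux_chain.simps [simp del]

lemma chain_initial: "m \<le> p \<Longrightarrow> darboux_chain p \<alpha> m = 1"
  by (simp add: darboux_chain.simps)

lemma chain_step:
  "darboux_chain p \<alpha> (m + p + 1) =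
     (if (p + 1) dvd m then [:0, 1:] else 1) * darboux_chain p \<alpha> (m + p)
       - Polynomial.smult (\<alpha> (m + 1)) (darboux_chain p \<alpha> m)"
proof -
  have "(p + 1) dvd (m + p + 1) \<longleftrightarrow> (p + 1) dvd m"
    by (metis add.assoc dvd_add_triv_right_iff)
  then show ?thesis
    by (subst darboux_chain.simps) (auto simp del: mult_pCons_left)
qed

lemma chain_cases:
  obtains "m \<le> p" | n where "m = n + p + (1::nat)"
proof (cases "m \<le> p")
  case False
  then have "m = (m - p - 1) + p + 1" by simp
  then show ?thesis using that by blast
qed (use that in blast)

lemma div_step:
  fixes m p :: nat
  shows "(m + p + 1) div (p + 1) = m div (p + 1) + 1"
    and "(m + p) div (p + 1) = (if (p + 1) dvd m then m div (p + 1) else m div (p + 1) + 1)"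
proof -
  show "(m + p + 1) div (p + 1) = m div (p + 1) + 1"
    by (metis add.assoc add_eq_0_iff_both_eq_0 div_add_self2 zero_neq_one)
  then show "(m + p) div (p + 1) = (if (p + 1) dvd m then m div (p + 1) else m div (p + 1) + 1)"
    using div_Suc[of "m + p" "p + 1"] dvd_add_triv_right_iff[of "p + 1" m]
    by (auto simp: dvd_eq_mod_eq_0)
qed

lemma chain_degree_coeff:
  "degree (darboux_chain p \<alpha> m) \<le> m div (p + 1) \<and> coeff (darboux_chain p \<alpha> m) (m div (p + 1)) = 1"
proof (induction m rule: less_induct)
  case (less m)
  show ?case
  proof (cases rule: chain_cases[of m p])
    case 1
    then show ?thesis by (simp add: chain_initial)
  next
    case (2 n)
    let ?k = "n div (p + 1)"
    have IH: "degree (darboux_chain p \<alpha> n) \<le> ?k"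
      "degree (darboux_chain p \<alpha> (n + p)) \<le> (n + p) div (p + 1)"
      "coeff (darboux_chain p \<alpha> (n + p)) ((n + p) div (p + 1)) = 1"
      using less[of n] less[of "n + p"] 2 by auto
    define g where "g = (if (p + 1) dvd n then [:0, 1:] else 1) * darboux_chain p \<alpha> (n + p)"
    have g: "degree g \<le> ?k + 1" "coeff g (?k + 1) = 1"
      using IH(2,3) degree_pCons_le[of 0 "darboux_chain p \<alpha> (n + p)"] unfolding g_def div_step(2)
      by (auto simp: coeff_pCons split: if_splits nat.split)
    have "degree (g - Polynomial.smult (\<alpha> (n + 1)) (darboux_chain p \<alpha> n)) \<le> ?k + 1"
      using g(1) IH(1) degree_smult_le[of "\<alpha> (n+1)" "darboux_chain p \<alpha> n"] by (intro degree_diff_le) auto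
    moreover have "coeff (darboux_chain p \<alpha> n) (?k + 1) = 0"
      using IH(1) by (intro coeff_eq_0) simp
    ultimately show ?thesis
      unfolding 2 chain_step div_step(1) using g(2) by (simp add: g_def del: mult_pCons_left)
  qed
qed

lemma degree_chain: "degree (darboux_chain p \<alpha> m) = m div (p + 1)"
  using chain_degree_coeff[of p \<alpha> m] le_degree[of "darboux_chain p \<alpha> m" "m div (p + 1)"] by simp

lemma chain_monic: "lead_coeff (darboux_chain p \<alpha> m) = 1"
  using chain_degree_coeff[of p \<alpha> m] by (simp add: degree_chain)

text \<open>The two terms of the recurrence never cancel at \<open>0\<close>: either the first one vanishes there, or
  both have the same sign because the degrees of \<open>P\<^bsub>m+p\<^esub>\<close> and \<open>P\<^sub>m\<close> have different parities.\<close>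

lemma chain_sign_at_0:
  assumes pos: "\<forall>i\<ge>1. \<alpha> i > 0"
  shows "0 < (-1) ^ (m div (p + 1)) * poly (darboux_chain p \<alpha> m) 0"
proof (induction m rule: less_induct)
  case (less m)
  show ?case
  proof (cases rule: chain_cases[of m p])
    case 1
    then show ?thesis by (simp add: chain_initial)
  next
    case (2 n)
    let ?k = "n div (p + 1)"
    have n: "0 < (-1) ^ ?k * poly (darboux_chain p \<alpha> n) 0"
      using less[of n] 2 by simp
    have "0 < \<alpha> (n + 1) * ((-1) ^ ?k * poly (darboux_chain p \<alpha> n) 0)"
      using n pos by simp
    moreover have "0 < - ((-1) ^ ?k * poly (darboux_chain p \<alpha> (n + p)) 0)" if "\<not> (p + 1) dvd n"
      using less[of "n + p"] 2 that unfolding div_step(2) by simp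
    ultimately show ?thesis
      unfolding 2 div_step(1) chain_step by (auto simp: algebra_simps)
  qed
qed

text \<open>Any two members of the chain at distance at most \<open>p\<close> interlace. At a zero \<open>y\<close> of \<open>P\<^sub>i\<close> with
  \<open>n < i \<le> n + p\<close>, the recurrence gives \<open>P\<^bsub>n+p+1\<^esub>(y)\<close> as a positive multiple of \<open>P\<^bsub>n+p\<^esub>(y)\<close> minus a
  positive multiple of \<open>P\<^sub>n(y)\<close>. As \<open>P\<^sub>i\<close> interlaces with \<open>P\<^bsub>n+p\<^esub>\<close> on its left and with \<open>P\<^sub>n\<close> on its
  right, both contributions have the sign that \<open>interlacedI\<close> asks for; the first one is zero if
  \<open>i = n + p\<close>. Positivity of the zeros matters here, as the factor in front of \<open>P\<^bsub>n+p\<^esub>\<close> may be \<open>x\<close>.\<close>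

lemma chain_interlaced:
  assumes pos: "\<forall>i\<ge>1. \<alpha> i > 0" and "p \<ge> 1"
  shows "pos_simple_zeros (darboux_chain p \<alpha> k) \<and>
         (\<forall>i<k. k \<le> i + p \<longrightarrow> interlaced (darboux_chain p \<alpha> i) (darboux_chain p \<alpha> k))"
proof (induction k rule: less_induct)
  case (less k)
  let ?P = "darboux_chain p \<alpha>"
  show ?case
  proof (cases rule: chain_cases[of k p])
    case 1
    then show ?thesis by (simp add: chain_initial pos_simple_zeros_def interlaced_def)
  next
    case (2 n)
    have main: "interlaced (?P i) (?P k)" if i: "i < k" "k \<le> i + p" for i
    proof (rule interlacedI)
      show Pi: "pos_simple_zeros (?P i)" using less[OF i(1)] by simp
      show "lead_coeff (?P k) = 1" by (rule chain_monic)
      show "degree (?P i) \<le> degree (?P k)"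
        using i by (simp add: degree_chain div_le_mono)
      have "k div (p + 1) \<le> (i + p + 1) div (p + 1)" using i by (intro div_le_mono) simp
      then show "degree (?P k) \<le> degree (?P i) + 1"
        by (simp add: degree_chain div_step(1)[simplified])
      show "0 < (-1) ^ degree (?P k) * poly (?P k) 0"
        unfolding degree_chain by (rule chain_sign_at_0[OF pos])
      show "0 < (-1) ^ Suc r * poly (?P k) (desc_zero (?P i) r)" if r: "r < degree (?P i)" for r
      proof -
        let ?x = "desc_zero (?P i) r"
        have x: "0 < ?x" using Pi r by (simp add: pos_simple_zeros_def)
        have "interlaced (?P n) (?P i)" using less[OF i(1)] i 2 by auto
        from interlaced_sign_left_at_right[OF this r]
        have a: "0 < \<alpha> (n + 1) * ((-1) ^ r * poly (?P n) ?x)" using pos by simp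
        have b: "0 \<le> (-1) ^ Suc r * poly (?P (n + p)) ?x"
        proof (cases "i = n + p")
          case True
          have "poly (?P i) ?x = 0" by (rule desc_zero_is_zero[OF Pi r])
          then show ?thesis using True by simp
        next
          case False
          then have "interlaced (?P i) (?P (n + p))" using less[of "n + p"] i 2 by auto
          from interlaced_sign_right_at_left[OF this r] show ?thesis by simp
        qed
        have "0 \<le> ?x * ((-1) ^ Suc r * poly (?P (n + p)) ?x)" using x by (intro mult_nonneg_nonneg[OF _ b]) simp
        then show ?thesis
          using a b unfolding 2 chain_step by (auto simp: algebra_simps)
      qed
    qed
    moreover have "pos_simple_zeros (?P k)"
      using main[of "k - 1"] 2 \<open>p \<ge> 1\<close> by (simp add: interlaced_def)
    ultimately show ?thesis by blast
  qed
qed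

section \<open>The factors of the Hessenberg matrix\<close>

lemma si_mult_L_factor:
  assumes pos: "\<forall>i\<ge>1. \<alpha> i > 0"
  shows "si_mult (L_factor p \<alpha> k) B i j =
    B i j + (if i = 0 then 0 else \<alpha> (k + 1 + (i - 1) * (p + 1)) * B (i - 1) j)"
proof (cases i)
  case 0
  have "{l. L_factor p \<alpha> k 0 l \<noteq> 0} = {0}" by (auto simp: L_factor_def)
  then show ?thesis using 0 by (simp add: si_mult_def L_factor_def)
next
  case (Suc i')
  have "\<alpha> (k + 1 + i' * (p + 1)) \<noteq> 0"
    using pos by (metis le_add1 le_add2 le_trans less_irrefl)
  then have "{l. L_factor p \<alpha> k (Suc i') l \<noteq> 0} = {i', Suc i'}"
    by (auto simp: L_factor_def split: if_splits)
  then show ?thesis using Suc by (simp add: si_mult_def L_factor_def)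
qed

text \<open>The tails of the factorization, from \<open>U\<close> for \<open>k = p + 1\<close> to \<open>T\<close> for \<open>k = 1\<close>: properties of \<open>T\<close>
  follow by inserting one bidiagonal factor after the other, an induction downwards in \<open>k\<close>.\<close>

definition partial_product :: "nat \<Rightarrow> (nat \<Rightarrow> real) \<Rightarrow> nat \<Rightarrow> si_matrix" where
  "partial_product p \<alpha> k = foldr (\<lambda>k. si_mult (L_factor p \<alpha> k)) [k..<p + 1] (U_factor p \<alpha>)"

lemma partial_product_last: "partial_product p \<alpha> (p + 1) = U_factor p \<alpha>"
  by (simp add: partial_product_def)

lemma partial_product_step:
  "k \<le> p \<Longrightarrow> partial_product p \<alpha> k = si_mult (L_factor p \<alpha> k) (partial_product p \<alpha> (k + 1))"
  using upt_conv_Cons[of k "p + 1"] by (simp add: partial_product_def del: upt_Suc)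

lemma partial_product_induct [consumes 2, case_names base step]:
  assumes pos: "\<forall>i\<ge>1. \<alpha> i > 0" and "k \<le> p + 1"
    and base: "P (p + 1) (U_factor p \<alpha>)"
    and step: "\<And>k B. k \<le> p \<Longrightarrow> P (k + 1) B \<Longrightarrow>
      P k (\<lambda>i j. B i j + (if i = 0 then 0 else \<alpha> (k + 1 + (i - 1) * (p + 1)) * B (i - 1) j))"
  shows "P k (partial_product p \<alpha> k)"
  using \<open>k \<le> p + 1\<close>
proof (induction k rule: inc_induct)
  case base
  show ?case using assms(3) by (simp only: partial_product_last)
next
  case (step n)
  have "partial_product p \<alpha> n = (\<lambda>i j. partial_product p \<alpha> (n + 1) i j +
      (if i = 0 then 0 else \<alpha> (n + 1 + (i - 1) * (p + 1)) * partial_product p \<alpha> (n + 1) (i - 1) j))"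
    using step.hyps by (subst partial_product_step) (auto intro!: ext simp: si_mult_L_factor[OF pos])
  then show ?case
    using assms(4)[of n "partial_product p \<alpha> (n + 1)"] step by simp
qed

lemma partial_product_entries:
  assumes pos: "\<forall>i\<ge>1. \<alpha> i > 0" and "k \<le> p + 1"
  shows "(\<forall>i j. 0 \<le> partial_product p \<alpha> k i j) \<and> (\<forall>i. 0 < partial_product p \<alpha> k i i) \<and>
    (\<forall>i j. i + 1 < j \<longrightarrow> partial_product p \<alpha> k i j = 0)"
  using assms
proof (induction rule: partial_product_induct)
  case base
  have "0 < \<alpha> (Suc i)" for i using pos by simp
  then show ?case by (auto simp: U_factor_def less_imp_le)
next
  case (step k B)
  have "0 \<le> \<alpha> i" if "0 < i" for i using pos that by (simp add: less_imp_le)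
  then show ?case using step
    by (auto intro!: add_nonneg_nonneg add_pos_nonneg mult_nonneg_nonneg simp: less_imp_le)
qed

text \<open>In the notation above: \<open>L\<^sub>k \<dots> L\<^sub>p U F\<^sub>0 = x F\<^bsub>k-1\<^esub>\<close>.\<close>

lemma partial_product_chain:
  assumes pos: "\<forall>i\<ge>1. \<alpha> i > 0" and "1 \<le> k" "k \<le> p + 1"
  shows "(\<Sum>j\<le>i + 1. partial_product p \<alpha> k i j * poly (darboux_chain p \<alpha> ((p + 1) * j)) x)
    = x * poly (darboux_chain p \<alpha> ((p + 1) * i + (k - 1))) x"
proof -
  define Q where "Q k B \<longleftrightarrow> 1 \<le> k \<longrightarrow> (\<forall>i j. i + 1 < j \<longrightarrow> B i j = 0) \<and>
     (\<forall>i. (\<Sum>j\<le>i + 1. B i j * poly (darboux_chain p \<alpha> ((p + 1) * j)) x)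
        = x * poly (darboux_chain p \<alpha> ((p + 1) * i + (k - 1))) x)" for k and B :: si_matrix
  have "Q k (partial_product p \<alpha> k)"
    using pos \<open>k \<le> p + 1\<close>
  proof (induction rule: partial_product_induct)
    case base
    have "(\<Sum>j\<le>i + 1. U_factor p \<alpha> i j * poly (darboux_chain p \<alpha> ((p + 1) * j)) x)
        = x * poly (darboux_chain p \<alpha> ((p + 1) * i + p)) x" for i
    proof -
      have "(\<Sum>j\<le>i + 1. U_factor p \<alpha> i j * poly (darboux_chain p \<alpha> ((p + 1) * j)) x)
        = (\<Sum>j\<in>{i, i + 1}. U_factor p \<alpha> i j * poly (darboux_chain p \<alpha> ((p + 1) * j)) x)"
        by (intro sum.mono_neutral_right) (auto simp: U_factor_def)
      also have "\<dots> = \<alpha> (1 + i * (p + 1)) * poly (darboux_chain p \<alpha> ((p + 1) * i)) x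
          + poly (darboux_chain p \<alpha> ((p + 1) * i + p + 1)) x"
        by (simp add: U_factor_def algebra_simps)
      also have "\<dots> = x * poly (darboux_chain p \<alpha> ((p + 1) * i + p)) x"
        by (simp only: chain_step dvd_triv_left if_True) (simp add: algebra_simps)
      finally show ?thesis .
    qed
    then show ?case by (auto simp: Q_def U_factor_def)
  next
    case (step k B)
    show ?case
      unfolding Q_def
    proof (intro impI conjI allI)
      assume k: "1 \<le> k"
      with step have B0: "\<And>i j. i + 1 < j \<Longrightarrow> B i j = 0"
        and B: "\<And>i. (\<Sum>j\<le>i + 1. B i j * poly (darboux_chain p \<alpha> ((p + 1) * j)) x)
        = x * poly (darboux_chain p \<alpha> ((p + 1) * i + k)) x"
        by (auto simp: Q_def)
      show "B i j + (if i = 0 then 0 else \<alpha> (k + 1 + (i - 1) * (p + 1)) * B (i - 1) j) = 0"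
        if "i + 1 < j" for i j using B0 that by simp
      show "(\<Sum>j\<le>i + 1. (B i j + (if i = 0 then 0 else \<alpha> (k + 1 + (i - 1) * (p + 1)) * B (i - 1) j))
           * poly (darboux_chain p \<alpha> ((p + 1) * j)) x) = x * poly (darboux_chain p \<alpha> ((p + 1) * i + (k - 1))) x" for i
      proof (cases i)
        case 0
        then show ?thesis using B[of 0] k step.hyps by (simp add: chain_initial)
      next
        case (Suc l)
        let ?c = "\<alpha> (k + 1 + l * (p + 1))"
        let ?f = "\<lambda>j. poly (darboux_chain p \<alpha> ((p + 1) * j)) x"
        have "(\<Sum>j\<le>i + 1. (B i j + ?c * B l j) * ?f j)
            = (\<Sum>j\<le>i + 1. B i j * ?f j) + ?c * (\<Sum>j\<le>i + 1. B l j * ?f j)"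
          by (simp add: sum_distrib_left sum.distrib algebra_simps)
        also have "(\<Sum>j\<le>i + 1. B l j * ?f j) = (\<Sum>j\<le>l + 1. B l j * ?f j)"
          using B0[of l "i + 1"] Suc by simp
        also have "(\<Sum>j\<le>i + 1. B i j * ?f j) + ?c * (\<Sum>j\<le>l + 1. B l j * ?f j)
            = x * (poly (darboux_chain p \<alpha> ((p + 1) * l + k + p + 1)) x
                   + ?c * poly (darboux_chain p \<alpha> ((p + 1) * l + k)) x)"
          unfolding B Suc by (simp add: algebra_simps)
        also have "\<dots> = x * poly (darboux_chain p \<alpha> ((p + 1) * l + k + p)) x"
        proof -
          have "\<not> (p + 1) dvd k"
            using k step.hyps by (simp add: nat_dvd_not_less)
          then have "\<not> (p + 1) dvd ((p + 1) * l + k)"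
            by (metis dvd_add_right_iff dvd_triv_left)
          then show ?thesis
            unfolding chain_step by (simp add: algebra_simps)
        qed
        also have "(p + 1) * l + k + p = (p + 1) * i + (k - 1)"
          using k Suc by simp
        finally show ?thesis using Suc by simp
      qed
    qed
  qed
  then show ?thesis using \<open>1 \<le> k\<close> by (simp add: Q_def)
qed

context
  fixes p :: nat and T :: si_matrix and \<alpha> :: "nat \<Rightarrow> real"
  assumes fact: "positive_bidiagonal_factorization p \<alpha> T"
begin

lemma factorization_nonneg: "0 \<le> T i j"
  and factorization_diag_pos: "0 < T i i"
  and factorization_hessenberg: "i + 1 < j \<Longrightarrow> T i j = 0"
  using partial_product_entries[of \<alpha> 1 p] fact
  by (auto simp: positive_bidiagonal_factorization_def partial_product_def)

lemma factorization_subdiag_pos: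
  assumes p: "p \<ge> 1"
  shows "0 < T (i + 1) i"
proof -
  have pos: "\<forall>i\<ge>1. \<alpha> i > 0" and "T = partial_product p \<alpha> 1"
    using fact by (auto simp: positive_bidiagonal_factorization_def partial_product_def)
  then have "T = si_mult (L_factor p \<alpha> 1) (partial_product p \<alpha> 2)"
    using p partial_product_step[of 1 p \<alpha>] by (simp add: numeral_2_eq_2)
  moreover have "0 < \<alpha> (Suc m)" for m using pos by simp
  ultimately show ?thesis
    using partial_product_entries[OF pos, of 2 p] p
    by (auto simp: si_mult_L_factor[OF pos] intro!: add_nonneg_pos)
qed

text \<open>Both sequences start with \<open>1\<close> and satisfy \<open>T F = x F\<close>, and the unit superdiagonal of \<open>T\<close>
  determines each term of such a sequence from the previous ones.\<close>

lemma typeII_eq_chain: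
  assumes banded: "banded_monic_hessenberg p T"
  shows "typeII p T n = darboux_chain p \<alpha> ((p + 1) * n)"
proof (induction n rule: less_induct)
  case (less n)
  show ?case
  proof (cases n)
    case 0
    then show ?thesis by (simp add: chain_initial)
  next
    case (Suc m)
    have "poly (typeII p T n) x = poly (darboux_chain p \<alpha> ((p + 1) * n)) x" for x
    proof -
      let ?f = "\<lambda>j. poly (darboux_chain p \<alpha> ((p + 1) * j)) x"
      have pos: "\<forall>i\<ge>1. \<alpha> i > 0" and T: "T = partial_product p \<alpha> 1"
        using fact by (auto simp: positive_bidiagonal_factorization_def partial_product_def)
      have "x * ?f m = (\<Sum>j\<le>m + 1. T m j * ?f j)"
        using partial_product_chain[OF pos, of 1 p m x] T by simp
      also have "\<dots> = ?f n + (\<Sum>j\<le>m. T m j * ?f j)"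
        using banded Suc by (simp add: banded_monic_hessenberg_def add.left_commute)
      also have "(\<Sum>j\<le>m. T m j * ?f j) = (\<Sum>j\<in>{m - p..m}. T m j * ?f j)"
        using banded by (intro sum.mono_neutral_right) (auto simp: banded_monic_hessenberg_def)
      also have "\<dots> = (\<Sum>j\<in>{m - p..m}. T m j * poly (typeII p T j) x)"
        using less Suc by (intro sum.cong) auto
      finally show ?thesis
        using less[of m] Suc by (simp add: poly_sum algebra_simps)
    qed
    then show ?thesis by (metis poly_eqI2 poly_eq_poly_eq_iff ext)
  qed
qed

end

lemma typeII_degree_monic:
  "degree (typeII p T n) = n \<and> lead_coeff (typeII p T n) = 1"
proof (induction n rule: less_induct)
  case (less n)
  show ?case
  proof (cases n)
    case (Suc m)
    define s where "s = (\<Sum>i\<in>{m - p..m}. Polynomial.smult (T m i) (typeII p T i))"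
    have "degree s \<le> m"
      unfolding s_def
    proof (intro degree_sum_le)
      fix i assume "i \<in> {m - p..m}"
      then have "degree (typeII p T i) \<le> m" using less[of i] Suc by simp
      then show "degree (Polynomial.smult (T m i) (typeII p T i)) \<le> m"
        using degree_smult_le[of "T m i" "typeII p T i"] by linarith
    qed simp
    moreover have m: "degree (typeII p T m) = m" "coeff (typeII p T m) m = 1"
      using less[of m] Suc by auto
    then have "degree ([:0, 1:] * typeII p T m) = Suc m"
      by (subst degree_mult_eq) auto
    ultimately have "degree ([:0, 1:] * typeII p T m - s) = Suc m"
      by (subst diff_conv_add_uminus, subst degree_add_eq_left) auto
    moreover have "coeff s (Suc m) = 0"
      using \<open>degree s \<le> m\<close> by (simp add: coeff_eq_0)
    ultimately show ?thesis
      using m Suc by (simp add: s_def)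
  qed simp
qed

lemma typeII_recurrence:
  assumes "banded_monic_hessenberg p T"
  shows "x * poly (typeII p T n) x = (\<Sum>j\<le>n + 1. T n j * poly (typeII p T j) x)"
proof -
  have "(\<Sum>j\<le>n + 1. T n j * poly (typeII p T j) x) =
      poly (typeII p T (Suc n)) x + (\<Sum>j\<le>n. T n j * poly (typeII p T j) x)"
    using assms by (simp add: banded_monic_hessenberg_def)
  also have "(\<Sum>j\<le>n. T n j * poly (typeII p T j) x) = (\<Sum>j\<in>{n - p..n}. T n j * poly (typeII p T j) x)"
    using assms by (intro sum.mono_neutral_right) (auto simp: banded_monic_hessenberg_def)
  finally show ?thesis by (simp add: poly_sum)
qed

section \<open>The quadrature sum as a moment of the truncation\<close>

lemma mat_inv_works:
  assumes A: "A \<in> carrier_mat n n" and "det A \<noteq> 0"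
  shows "mat_inv A \<in> carrier_mat n n" "A * mat_inv A = 1\<^sub>m n" "mat_inv A * A = 1\<^sub>m n"
proof -
  have "mat_inverse A \<noteq> None"
    using mat_inverse(1)[OF A, of "()"] det_non_zero_imp_unit[OF assms, of "()"] by blast
  then obtain B where "mat_inverse A = Some B" by blast
  then show "mat_inv A \<in> carrier_mat n n" "A * mat_inv A = 1\<^sub>m n" "mat_inv A * A = 1\<^sub>m n"
    using mat_inverse(2)[OF A] by (auto simp: mat_inv_def)
qed

lemma mult_mat_entry:
  "A \<in> carrier_mat n m \<Longrightarrow> B \<in> carrier_mat m l \<Longrightarrow> i < n \<Longrightarrow> j < l \<Longrightarrow>
    (A * B) $$ (i, j) = (\<Sum>k<m. A $$ (i, k) * B $$ (k, j))"
  by (simp add: scalar_prod_def atLeast0LessThan)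

lemma lower_unitriangular_inverse:
  assumes \<nu>: "\<nu> \<in> carrier_mat p p" "lower_unitriangular \<nu>"
  shows "mat_inv \<nu> \<in> carrier_mat p p" "mat_inv \<nu> * \<nu> = 1\<^sub>m p"
proof -
  have ut: "upper_triangular (transpose_mat \<nu>)"
    and diag: "\<And>i. i < p \<Longrightarrow> transpose_mat \<nu> $$ (i, i) = 1"
    using \<nu> by (auto simp: lower_unitriangular_def upper_unitriangular_def)
  have "det \<nu> = det (transpose_mat \<nu>)"
    using \<nu>(1) by (simp add: det_transpose)
  also have "\<dots> = prod_list (diag_mat (transpose_mat \<nu>))"
    using \<nu>(1) ut by (intro det_upper_triangular) auto
  also have "\<dots> = 1"
    using diag \<nu>(1) by (auto simp: prod_list_diag_prod intro!: prod.neutral)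
  finally have "det \<nu> \<noteq> 0" by simp
  then show "mat_inv \<nu> \<in> carrier_mat p p" "mat_inv \<nu> * \<nu> = 1\<^sub>m p"
    using mat_inv_works \<nu>(1) by blast+
qed

lemma e_nu_entry:
  assumes "mat_inv \<nu> \<in> carrier_mat p p" "a \<in> {1..p}"
  shows "e_nu p \<nu> a i = (if i < p then mat_inv \<nu> $$ (a - 1, i) else 0)"
  using assms by (auto simp: e_nu_def)

lemma moment_trunc_eq_sum:
  "moment_trunc p T \<nu> N a n = (\<Sum>i\<le>N. (si_trunc T N ^\<^sub>m n) $$ (0, i) * e_nu p \<nu> a i)"
proof -
  have "si_trunc T N \<in> carrier_mat (N + 1) (N + 1)" by (simp add: si_trunc_def)
  then have M: "si_trunc T N ^\<^sub>m n \<in> carrier_mat (N + 1) (N + 1)" by (rule pow_carrier_mat)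
  let ?v = "(si_trunc T N ^\<^sub>m n) *\<^sub>v vec (N + 1) (e_nu p \<nu> a)"
  have v: "?v \<in> carrier_vec (N + 1)" using M by (intro mult_mat_vec_carrier) auto
  have "moment_trunc p T \<nu> N a n = ?v $ 0"
    unfolding moment_trunc_def by (rule scalar_prod_left_unit[OF v]) simp
  then show ?thesis
    using carrier_matD[OF M] by (simp add: scalar_prod_def atLeast0LessThan lessThan_Suc_atMost)
qed

lemma trunc_power_row:
  assumes "j \<le> N"
  shows "(si_trunc T N ^\<^sub>m 0) $$ (0, j) = (if j = 0 then 1 else 0)"
    and "(si_trunc T N ^\<^sub>m Suc n) $$ (0, j) = (\<Sum>i\<le>N. (si_trunc T N ^\<^sub>m n) $$ (0, i) * T i j)"
proof -
  have A: "si_trunc T N \<in> carrier_mat (N + 1) (N + 1)" by (simp add: si_trunc_def)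
  show "(si_trunc T N ^\<^sub>m 0) $$ (0, j) = (if j = 0 then 1 else 0)"
    using assms by (simp add: si_trunc_def)
  have "(si_trunc T N ^\<^sub>m Suc n) $$ (0, j)
      = (\<Sum>i<N + 1. (si_trunc T N ^\<^sub>m n) $$ (0, i) * si_trunc T N $$ (i, j))"
    using assms by (simp only: pow_mat.simps, intro mult_mat_entry[OF pow_carrier_mat[OF A] A]) auto
  also have "\<dots> = (\<Sum>i\<le>N. (si_trunc T N ^\<^sub>m n) $$ (0, i) * T i j)"
    using assms by (intro sum.cong) (auto simp: si_trunc_def)
  finally show "(si_trunc T N ^\<^sub>m Suc n) $$ (0, j) = (\<Sum>i\<le>N. (si_trunc T N ^\<^sub>m n) $$ (0, i) * T i j)" .
qed

lemma si_power_row_support: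
  assumes hess: "\<And>i j. i + 1 < j \<Longrightarrow> T i j = 0"
  shows "n < j \<Longrightarrow> si_power T n 0 j = 0"
proof (induction n arbitrary: j)
  case 0
  then show ?case by (simp add: si_one_def)
next
  case (Suc n)
  have "si_power T n 0 i * T i j = 0" for i
    using Suc.IH[of i] hess[of i j] Suc.prems by (cases "i \<le> n") auto
  then show ?case
    unfolding si_power.simps si_mult_def by (intro sum.neutral) blast
qed

lemma si_power_row_Suc:
  assumes hess: "\<And>i j. i + 1 < j \<Longrightarrow> T i j = 0" and "n \<le> m"
  shows "si_power T (Suc n) 0 j = (\<Sum>i\<le>m. si_power T n 0 i * T i j)"
proof -
  have "i \<le> m" if "si_power T n 0 i \<noteq> 0" for i
    using that \<open>n \<le> m\<close> si_power_row_support[of T n i, OF hess] by (meson not_less order_trans)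
  then show ?thesis
    by (auto simp: si_mult_def intro!: sum.mono_neutral_left)
qed

text \<open>The column \<open>B\<close> of the \<open>B\<^sub>n\<close> satisfies \<open>T B = x B\<close>, hence \<open>T\<^sup>n B = x\<^sup>n B\<close>, whose first entry is
  this expansion.\<close>

lemma monomial_in_typeII:
  assumes "banded_monic_hessenberg p T"
  shows "x ^ n = (\<Sum>l\<le>n. si_power T n 0 l * poly (typeII p T l) x)"
proof (induction n)
  case 0
  show ?case by (simp add: si_one_def)
next
  case (Suc n)
  have hess: "T i j = 0" if "i + 1 < j" for i j
    using assms that by (simp add: banded_monic_hessenberg_def)
  have "x ^ Suc n = (\<Sum>l\<le>n. si_power T n 0 l * (x * poly (typeII p T l) x))"
    by (simp add: Suc.IH sum_distrib_left algebra_simps)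
  also have "\<dots> = (\<Sum>l\<le>n. \<Sum>j\<le>n + 1. si_power T n 0 l * (T l j * poly (typeII p T j) x))"
  proof (intro sum.cong refl)
    fix l assume "l \<in> {..n}"
    then have "(\<Sum>j\<le>l + 1. T l j * poly (typeII p T j) x) = (\<Sum>j\<le>n + 1. T l j * poly (typeII p T j) x)"
      by (intro sum.mono_neutral_left) (auto simp: hess)
    then show "si_power T n 0 l * (x * poly (typeII p T l) x) =
        (\<Sum>j\<le>n + 1. si_power T n 0 l * (T l j * poly (typeII p T j) x))"
      by (simp only: typeII_recurrence[OF assms] sum_distrib_left)
  qed
  also have "\<dots> = (\<Sum>j\<le>n + 1. (\<Sum>l\<le>n. si_power T n 0 l * T l j) * poly (typeII p T j) x)"
    by (subst sum.swap) (simp only: sum_distrib_right mult.assoc)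
  also have "\<dots> = (\<Sum>j\<le>Suc n. si_power T (Suc n) 0 j * poly (typeII p T j) x)"
    by (simp only: si_power_row_Suc[of T, OF hess order_refl] Suc_eq_plus1[symmetric])
  finally show ?case .
qed

text \<open>At a zero of \<open>B\<^bsub>N+1\<^esub>\<close> the truncated column is an eigenvector of \<open>T\<^sup>[\<^sup>N\<^sup>]\<close>, the only term that
  the truncation cuts off being a multiple of \<open>B\<^bsub>N+1\<^esub>\<close>.\<close>

lemma power_of_zero_in_typeII:
  assumes "banded_monic_hessenberg p T" and zero: "poly (typeII p T (N + 1)) x = 0"
  shows "x ^ n = (\<Sum>l\<le>N. (si_trunc T N ^\<^sub>m n) $$ (0, l) * poly (typeII p T l) x)"
proof (induction n)
  case 0
  have "(\<Sum>l\<le>N. (si_trunc T N ^\<^sub>m 0) $$ (0, l) * poly (typeII p T l) x)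
      = (\<Sum>l\<le>N. if l = 0 then 1 else 0)"
    by (intro sum.cong) (auto simp: trunc_power_row(1) simp del: pow_mat.simps)
  then show ?case by simp
next
  case (Suc n)
  have hess: "T i j = 0" if "i + 1 < j" for i j
    using assms that by (simp add: banded_monic_hessenberg_def)
  let ?w = "\<lambda>n j. (si_trunc T N ^\<^sub>m n) $$ (0, j)"
  have "x ^ Suc n = (\<Sum>l\<le>N. ?w n l * (x * poly (typeII p T l) x))"
    by (simp add: Suc.IH sum_distrib_left algebra_simps)
  also have "\<dots> = (\<Sum>l\<le>N. \<Sum>j\<le>N. ?w n l * (T l j * poly (typeII p T j) x))"
  proof (intro sum.cong refl)
    fix l assume "l \<in> {..N}"
    then have "(\<Sum>j\<le>l + 1. T l j * poly (typeII p T j) x) = (\<Sum>j\<le>N + 1. T l j * poly (typeII p T j) x)"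
      by (intro sum.mono_neutral_left) (auto simp: hess)
    also have "\<dots> = (\<Sum>j\<le>N. T l j * poly (typeII p T j) x)" using zero by simp
    finally show "?w n l * (x * poly (typeII p T l) x) =
        (\<Sum>j\<le>N. ?w n l * (T l j * poly (typeII p T j) x))"
      by (simp only: typeII_recurrence[OF assms(1)] sum_distrib_left)
  qed
  also have "\<dots> = (\<Sum>j\<le>N. (\<Sum>l\<le>N. ?w n l * T l j) * poly (typeII p T j) x)"
    by (subst sum.swap) (simp only: sum_distrib_right mult.assoc)
  also have "\<dots> = (\<Sum>j\<le>N. ?w (Suc n) j * poly (typeII p T j) x)"
    by (intro sum.cong) (simp_all add: trunc_power_row(2) del: pow_mat.simps)
  finally show ?case .
qed

lemma monic_family_independent:
  fixes c :: "nat \<Rightarrow> real"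
  assumes B: "\<And>i. degree (B i) = i \<and> lead_coeff (B i) = (1::real)"
    and "(\<Sum>i<m. Polynomial.smult (c i) (B i)) = 0" "i < m"
  shows "c i = 0"
  using assms(2,3)
proof (induction m)
  case (Suc m)
  have "coeff (\<Sum>i<m. Polynomial.smult (c i) (B i)) m = 0"
    using B by (auto simp: coeff_sum coeff_eq_0 intro!: sum.neutral)
  moreover have "coeff (\<Sum>i<Suc m. Polynomial.smult (c i) (B i)) m = 0"
    using Suc.prems(1) by simp
  moreover have "coeff (B m) m = 1" using B[of m] by metis
  ultimately have "c m = 0" by simp
  then show ?case using Suc by (cases "i = m") auto
qed simp

text \<open>A vector annihilated by the transpose of \<open>(B\<^sub>i(\<lambda>\<^sub>k))\<close> is a polynomial of degree at most \<open>N\<close> with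
  \<open>N + 1\<close> zeros, written in the basis of the \<open>B\<^sub>i\<close>.\<close>

lemma det_script_U_nonzero:
  assumes inj: "inj_on (zeroB p T N) {1..N + 1}"
  shows "det (script_U p T N) \<noteq> 0"
proof
  assume "det (script_U p T N) = 0"
  have U: "script_U p T N \<in> carrier_mat (N + 1) (N + 1)" by (simp add: script_U_def)
  let ?B = "typeII p T"
  have "det (transpose_mat (script_U p T N)) = 0"
    using \<open>det (script_U p T N) = 0\<close> U by (simp add: det_transpose)
  then obtain v where v: "v \<in> carrier_vec (N + 1)" "v \<noteq> 0\<^sub>v (N + 1)"
    and ker: "transpose_mat (script_U p T N) *\<^sub>v v = 0\<^sub>v (N + 1)"
    using U det_0_iff_vec_prod_zero[of "transpose_mat (script_U p T N)" "N + 1"] by auto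
  define f where "f = (\<Sum>i<N + 1. Polynomial.smult (v $ i) (?B i))"
  have root: "poly f (zeroB p T N k) = 0" if "k \<in> {1..N + 1}" for k
  proof -
    have k: "k - 1 < N + 1" using that by auto
    have "0 = (transpose_mat (script_U p T N) *\<^sub>v v) $ (k - 1)"
      using ker k by simp
    also have "\<dots> = (\<Sum>i<N + 1. script_U p T N $$ (i, k - 1) * v $ i)"
      using U v(1) k by (simp add: scalar_prod_def atLeast0LessThan del: sum.lessThan_Suc)
    also have "\<dots> = (\<Sum>i<N + 1. v $ i * poly (?B i) (zeroB p T N k))"
      using that k by (intro sum.cong) (auto simp: script_U_def)
    finally show ?thesis by (simp add: f_def poly_sum)
  qed
  have "f = 0"
  proof (rule ccontr)
    assume "f \<noteq> 0"
    have "degree f \<le> N"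
      unfolding f_def
    proof (intro degree_sum_le)
      fix i assume "i \<in> {..<N + 1}"
      then show "degree (Polynomial.smult (v $ i) (?B i)) \<le> N"
        using degree_smult_le[of "v $ i" "?B i"] typeII_degree_monic[of p T i] by simp
    qed simp
    have "N + 1 = card (zeroB p T N ` {1..N + 1})"
      using inj by (simp add: card_image)
    also have "\<dots> \<le> card {x. poly f x = 0}"
      using root by (intro card_mono poly_roots_finite \<open>f \<noteq> 0\<close>) auto
    also have "\<dots> \<le> degree f"
      by (rule card_poly_roots_bound[OF \<open>f \<noteq> 0\<close>])
    finally show False using \<open>degree f \<le> N\<close> by simp
  qed
  then have "v $ i = 0" if "i < N + 1" for i
    using that \<open>f = 0\<close> typeII_degree_monic unfolding f_def
    by (intro monic_family_independent[where B = ?B and m = "N + 1"])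
  then have "v = 0\<^sub>v (N + 1)"
    using v(1) by (intro eq_vecI) auto
  then show False using v(2) by simp
qed

text \<open>The spectral decomposition of \<open>(T\<^sup>[\<^sup>N\<^sup>])\<^sup>n\<close> read off in its first row. Expanding \<open>\<lambda>\<^sub>k\<^sup>n\<close> in the
  \<open>B\<^sub>l(\<lambda>\<^sub>k)\<close> and multiplying by the inverse matrix recovers that row from the \<open>\<lambda>\<^sub>k\<^sup>n\<close>; its product with
  \<open>e\<^sub>a\<^sup>\<nu>\<close> collects the entries of the inverse matrix into the Christoffel numbers.\<close>

lemma quadrature_sum_eq_moment_trunc:
  assumes banded: "banded_monic_hessenberg p T"
    and inj: "inj_on (zeroB p T N) {1..N + 1}"
    and zero: "\<And>k. k \<in> {1..N + 1} \<Longrightarrow> poly (typeII p T (N + 1)) (zeroB p T N k) = 0"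
    and inv: "mat_inv \<nu> \<in> carrier_mat p p" and "a \<in> {1..p}" and "N \<ge> p - 1"
  shows "(\<Sum>k=1..N + 1. christoffel_number p T \<nu> N k a * zeroB p T N k ^ n) = moment_trunc p T \<nu> N a n"
proof -
  let ?U = "script_U p T N" and ?W = "script_W p T N" and ?e = "e_nu p \<nu> a"
  let ?w = "\<lambda>j. (si_trunc T N ^\<^sub>m n) $$ (0, j)"
  have U: "?U \<in> carrier_mat (N + 1) (N + 1)" by (simp add: script_U_def)
  have W: "?W \<in> carrier_mat (N + 1) (N + 1)" and UW: "?U * ?W = 1\<^sub>m (N + 1)"
    unfolding script_W_def using mat_inv_works[OF U det_script_U_nonzero[OF inj]] by auto
  have chr: "christoffel_number p T \<nu> N (k + 1) a = (\<Sum>i\<le>N. ?W $$ (k, i) * ?e i)" for k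
  proof -
    have "christoffel_number p T \<nu> N (k + 1) a = (\<Sum>i<p. mat_inv \<nu> $$ (a - 1, i) * ?W $$ (k, i))"
      using inv \<open>a \<in> {1..p}\<close> by (auto simp: christoffel_number_def scalar_prod_def atLeast0LessThan)
    also have "\<dots> = (\<Sum>i<p. ?W $$ (k, i) * ?e i)"
      by (intro sum.cong) (simp_all add: e_nu_entry[OF inv \<open>a \<in> {1..p}\<close>])
    also have "\<dots> = (\<Sum>i\<le>N. ?W $$ (k, i) * ?e i)"
      using \<open>N \<ge> p - 1\<close> by (intro sum.mono_neutral_left) (auto simp: e_nu_def)
    finally show ?thesis .
  qed
  have row: "?w i = (\<Sum>k\<le>N. zeroB p T N (k + 1) ^ n * ?W $$ (k, i))" if "i \<le> N" for i
  proof -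
    have "(\<Sum>k\<le>N. zeroB p T N (k + 1) ^ n * ?W $$ (k, i))
        = (\<Sum>k\<le>N. \<Sum>l\<le>N. ?w l * (?U $$ (l, k) * ?W $$ (k, i)))"
    proof (intro sum.cong refl)
      fix k assume k: "k \<in> {..N}"
      then have "zeroB p T N (k + 1) ^ n = (\<Sum>l\<le>N. ?w l * poly (typeII p T l) (zeroB p T N (k + 1)))"
        using power_of_zero_in_typeII[OF banded zero[of "k + 1"], of n] by simp
      also have "\<dots> = (\<Sum>l\<le>N. ?w l * ?U $$ (l, k))"
        using k by (intro sum.cong) (auto simp: script_U_def)
      finally show "zeroB p T N (k + 1) ^ n * ?W $$ (k, i) = (\<Sum>l\<le>N. ?w l * (?U $$ (l, k) * ?W $$ (k, i)))"
        by (simp only: sum_distrib_right mult.assoc)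
    qed
    also have "\<dots> = (\<Sum>l\<le>N. ?w l * (\<Sum>k\<le>N. ?U $$ (l, k) * ?W $$ (k, i)))"
      by (subst sum.swap) (simp only: sum_distrib_left)
    also have "\<dots> = (\<Sum>l\<le>N. ?w l * (if l = i then 1 else 0))"
    proof (intro sum.cong refl)
      fix l assume "l \<in> {..N}"
      then have "(\<Sum>k\<le>N. ?U $$ (l, k) * ?W $$ (k, i)) = (?U * ?W) $$ (l, i)"
        using mult_mat_entry[OF U W, of l i] that by (simp add: lessThan_Suc_atMost)
      then show "?w l * (\<Sum>k\<le>N. ?U $$ (l, k) * ?W $$ (k, i)) = ?w l * (if l = i then 1 else 0)"
        using \<open>l \<in> {..N}\<close> that by (simp add: UW)
    qed
    also have "\<dots> = ?w i" using that by (simp add: mult_delta_right)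
    finally show ?thesis by simp
  qed
  have "(\<Sum>k=1..N + 1. christoffel_number p T \<nu> N k a * zeroB p T N k ^ n)
      = (\<Sum>k\<le>N. christoffel_number p T \<nu> N (k + 1) a * zeroB p T N (k + 1) ^ n)"
    by (rule sum.reindex_bij_witness[of _ "\<lambda>k. k + 1" "\<lambda>k. k - 1"]) auto
  also have "\<dots> = (\<Sum>k\<le>N. \<Sum>i\<le>N. zeroB p T N (k + 1) ^ n * ?W $$ (k, i) * ?e i)"
    by (simp only: chr) (simp add: sum_distrib_left sum_distrib_right algebra_simps)
  also have "\<dots> = (\<Sum>i\<le>N. ?w i * ?e i)"
    by (subst sum.swap) (simp add: row sum_distrib_right)
  finally show ?thesis by (simp add: moment_trunc_eq_sum)
qed

section \<open>The integral as a moment of the semi-infinite matrix\<close>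

lemma set_integrable_poly_Icc:
  fixes F :: "real \<Rightarrow> real" and f :: "real poly"
  assumes "mono F" "\<And>x. continuous (at_right x) F"
  shows "set_integrable (interval_measure F) {c..d} (poly f)"
proof -
  have "emeasure (interval_measure F) {c..d} < \<infinity>"
  proof (cases "c \<le> d")
    case True
    have "emeasure (interval_measure F) {c..d} \<le> emeasure (interval_measure F) {c - 1<..d}"
      by (intro emeasure_mono) auto
    also have "\<dots> = ennreal (F d - F (c - 1))"
      using True assms by (intro emeasure_interval_measure_Ioc) (auto simp: mono_def)
    finally show ?thesis by (simp add: order_le_less_trans)
  qed simp
  moreover have "compact (poly f ` {c..d})"
    by (intro compact_continuous_image continuous_intros compact_Icc)
  then obtain K where "\<And>x. x \<in> {c..d} \<Longrightarrow> norm (poly f x) \<le> K"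
    by (metis compact_imp_bounded bounded_iff imageI)
  moreover have "poly f \<in> borel_measurable (interval_measure F)"
    using borel_measurable_continuous_onI[of "poly f"] by (simp add: continuous_on_poly)
  ultimately show ?thesis
    unfolding set_integrable_def
    by (intro integrableI_bounded_set_indicator[where B = K]) auto
qed

text \<open>The type I polynomials with index \<open>k < p\<close> are the constants in the rows of \<open>\<nu>\<close>, so
  biorthogonality with \<open>B\<^sub>l\<close> says that \<open>\<nu>\<close> times the matrix of the integrals of \<open>B\<^sub>l\<close> is the identity
  extended by zero columns. Hence the integrals of the \<open>B\<^sub>l\<close> against the \<open>a\<close>-th measure are the
  entries of \<open>e\<^sub>a\<^sup>\<nu>\<close>.\<close>

lemma moment_inf_eq_integral:
  assumes banded: "banded_monic_hessenberg p T"
    and inv: "mat_inv \<nu> \<in> carrier_mat p p" "mat_inv \<nu> * \<nu> = 1\<^sub>m p" and \<nu>: "\<nu> \<in> carrier_mat p p"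
    and spec: "spectral_measures p T \<nu> \<psi>" and a: "a \<in> {1..p}"
  shows "(LINT x:Delta p T|interval_measure (\<psi> a). x ^ n) = moment_inf p T \<nu> a n"
proof -
  let ?B = "typeII p T" and ?V = "mat_inv \<nu>"
  define M where "M b l = (LINT x:Delta p T|interval_measure (\<psi> (b + 1)). poly (?B l) x)" for b l
  have int: "set_integrable (interval_measure (\<psi> b)) (Delta p T) (poly f)" if "b \<in> {1..p}" for b f
    unfolding Delta_def using spec that
    by (intro set_integrable_poly_Icc) (auto simp: spectral_measures_def)
  have bio: "(\<Sum>b<p. \<nu> $$ (k, b) * M b l) = (if k = l then 1 else 0)" if "k < p" for k l
  proof -
    have "(if k = l then 1 else 0) = (\<Sum>b\<in>{1..p}. LINT x:Delta p T|interval_measure (\<psi> b).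
                poly (typeI p T \<nu> b k) x * poly (?B l) x)"
      using spec by (simp add: spectral_measures_def)
    also have "\<dots> = (\<Sum>b\<in>{1..p}. \<nu> $$ (k, b - 1) * M (b - 1) l)"
      using that by (intro sum.cong) (auto simp: typeI_initial M_def)
    also have "\<dots> = (\<Sum>b<p. \<nu> $$ (k, b) * M b l)"
      by (rule sum.reindex_bij_witness[of _ "\<lambda>b. b + 1" "\<lambda>b. b - 1"]) auto
    finally show ?thesis by simp
  qed
  have M: "M (a - 1) l = e_nu p \<nu> a l" for l
  proof -
    have a': "a - 1 < p" using a by auto
    have "M (a - 1) l = (\<Sum>b<p. (if a - 1 = b then 1 else 0) * M b l)"
      using a' by (simp add: mult_delta_left)
    also have "\<dots> = (\<Sum>b<p. (?V * \<nu>) $$ (a - 1, b) * M b l)"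
      using a' inv(2) by (intro sum.cong) auto
    also have "\<dots> = (\<Sum>b<p. (\<Sum>k<p. ?V $$ (a - 1, k) * \<nu> $$ (k, b)) * M b l)"
      by (intro sum.cong refl) (simp only: mult_mat_entry[OF inv(1) \<nu> a'] lessThan_iff)
    also have "\<dots> = (\<Sum>k<p. ?V $$ (a - 1, k) * (\<Sum>b<p. \<nu> $$ (k, b) * M b l))"
      unfolding sum_distrib_left sum_distrib_right by (subst sum.swap) (simp only: mult.assoc)
    also have "\<dots> = (\<Sum>k<p. ?V $$ (a - 1, k) * (if k = l then 1 else 0))"
      by (intro sum.cong) (simp_all add: bio)
    also have "\<dots> = e_nu p \<nu> a l"
      by (simp add: e_nu_entry[OF inv(1) a] mult_delta_right)
    finally show ?thesis .
  qed
  have hess: "T i j = 0" if "i + 1 < j" for i j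
    using banded that by (simp add: banded_monic_hessenberg_def)
  have "(LINT x:Delta p T|interval_measure (\<psi> a). x ^ n)
      = (LINT x:Delta p T|interval_measure (\<psi> a). (\<Sum>l\<le>n. si_power T n 0 l * poly (?B l) x))"
    by (simp only: monomial_in_typeII[OF banded, symmetric])
  also have "\<dots> = (LINT x|interval_measure (\<psi> a).
      (\<Sum>l\<le>n. si_power T n 0 l * (indicator (Delta p T) x *\<^sub>R poly (?B l) x)))"
    by (simp add: set_lebesgue_integral_def sum_distrib_left mult.left_commute)
  also have "\<dots> = (\<Sum>l\<le>n. LINT x|interval_measure (\<psi> a).
      si_power T n 0 l * (indicator (Delta p T) x *\<^sub>R poly (?B l) x))"
    using int[OF a] by (intro Bochner_Integration.integral_sum) (simp add: set_integrable_def)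
  also have "\<dots> = (\<Sum>l\<le>n. si_power T n 0 l * M (a - 1) l)"
    using a by (simp add: M_def set_lebesgue_integral_def)
  also have "\<dots> = (\<Sum>l\<le>n. si_power T n 0 l * e_nu p \<nu> a l)" by (simp only: M)
  also have "\<dots> = (\<Sum>l\<in>{l. l \<le> n \<and> e_nu p \<nu> a l \<noteq> 0}. si_power T n 0 l * e_nu p \<nu> a l)"
    by (intro sum.mono_neutral_right) auto
  also have "\<dots> = moment_inf p T \<nu> a n"
    unfolding moment_inf_def
  proof (intro sum.mono_neutral_left)
    have "{j. e_nu p \<nu> a j \<noteq> 0} \<subseteq> {..<p}" by (auto simp: e_nu_def split: if_splits)
    then show "finite {j. e_nu p \<nu> a j \<noteq> 0}" by (rule finite_subset) simp
    have "j \<le> n" if "si_power T n 0 j \<noteq> 0" for j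
      using si_power_row_support[of T n j, OF hess] that by (meson not_less)
    then show "\<forall>j\<in>{j. e_nu p \<nu> a j \<noteq> 0} - {l. l \<le> n \<and> e_nu p \<nu> a l \<noteq> 0}.
        si_power T n 0 j * e_nu p \<nu> a j = 0"
      by auto
  qed auto
  finally show ?thesis .
qed

section \<open>The remainder as a count of walks\<close>

text \<open>The total weight of the walks of length \<open>n\<close> from \<open>0\<close> to \<open>j\<close> that leave \<open>{0..N}\<close> at some time, where
  the weight of a walk is the product of \<open>T i l\<close> over its steps from \<open>i\<close> to \<open>l\<close>.\<close>

definition truncation_defect :: "si_matrix \<Rightarrow> nat \<Rightarrow> nat \<Rightarrow> nat \<Rightarrow> real" where
  "truncation_defect T N n j =
     si_power T n 0 j - (if j \<le> N then (si_trunc T N ^\<^sub>m n) $$ (0, j) else 0)"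

lemma truncation_defect_0: "truncation_defect T N 0 j = 0"
  by (simp add: truncation_defect_def si_one_def si_trunc_def)

context
  fixes T :: si_matrix
  assumes nonneg: "\<And>i j. 0 \<le> T i j"
    and hess: "\<And>i j. i + 1 < j \<Longrightarrow> T i j = 0"
begin

lemma trunc_power_row_nonneg: "j \<le> N \<Longrightarrow> 0 \<le> (si_trunc T N ^\<^sub>m n) $$ (0, j)"
proof (induction n arbitrary: j)
  case 0
  then show ?case by (simp add: trunc_power_row(1) del: pow_mat.simps)
next
  case (Suc n)
  then show ?case
    by (auto simp: trunc_power_row(2) nonneg intro!: sum_nonneg mult_nonneg_nonneg simp del: pow_mat.simps)
qed

text \<open>A walk that has left \<open>{0..N}\<close> and is prolonged by one step has still left it.
  Equality holds for \<open>j \<le> N\<close>; for \<open>j > N\<close> the last step may be the first one outside.\<close>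

lemma truncation_defect_recursion:
  "(\<Sum>i\<le>n + N. truncation_defect T N n i * T i j) \<le> truncation_defect T N (Suc n) j"
proof -
  let ?w = "\<lambda>n j. (si_trunc T N ^\<^sub>m n) $$ (0, j)"
  have "(\<Sum>i\<le>n + N. truncation_defect T N n i * T i j)
      = (\<Sum>i\<le>n + N. si_power T n 0 i * T i j)
        - (\<Sum>i\<le>n + N. if i \<le> N then ?w n i * T i j else 0)"
    unfolding sum_subtractf[symmetric]
    by (intro sum.cong) (auto simp: truncation_defect_def algebra_simps)
  also have "(\<Sum>i\<le>n + N. if i \<le> N then ?w n i * T i j else 0) = (\<Sum>i\<le>N. ?w n i * T i j)"
    by (intro sum.mono_neutral_cong_right) auto
  also have "(\<Sum>i\<le>n + N. si_power T n 0 i * T i j) = si_power T (Suc n) 0 j"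
    by (rule si_power_row_Suc[OF hess, symmetric]) auto
  also have "si_power T (Suc n) 0 j - (\<Sum>i\<le>N. ?w n i * T i j) \<le> truncation_defect T N (Suc n) j"
  proof (cases "j \<le> N")
    case True
    then show ?thesis
      by (simp add: truncation_defect_def trunc_power_row(2) del: pow_mat.simps si_power.simps)
  next
    case False
    have "0 \<le> (\<Sum>i\<le>N. ?w n i * T i j)"
      by (intro sum_nonneg mult_nonneg_nonneg nonneg trunc_power_row_nonneg) auto
    then show ?thesis using False
      by (simp add: truncation_defect_def del: pow_mat.simps si_power.simps)
  qed
  finally show ?thesis .
qed

lemma truncation_defect_nonneg: "0 \<le> truncation_defect T N n j"
proof (induction n arbitrary: j)
  case 0
  show ?case by (simp add: truncation_defect_0)
next
  case (Suc n)
  have "0 \<le> (\<Sum>i\<le>n + N. truncation_defect T N n i * T i j)"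
    by (intro sum_nonneg mult_nonneg_nonneg nonneg Suc.IH)
  then show ?case using truncation_defect_recursion by (rule order_trans)
qed

lemma truncation_defect_propagates:
  assumes "0 < truncation_defect T N n i" "0 < T i j"
  shows "0 < truncation_defect T N (Suc n) j"
proof -
  \<comment> \<open>Larger indices are out of reach in \<open>n\<close> steps.\<close>
  have "i \<le> n + N"
  proof (rule ccontr)
    assume "\<not> i \<le> n + N"
    then have "truncation_defect T N n i = 0"
      using si_power_row_support[of T n i, OF hess] by (simp add: truncation_defect_def)
    then show False using assms(1) by simp
  qed
  then have "truncation_defect T N n i * T i j \<le> (\<Sum>i\<le>n + N. truncation_defect T N n i * T i j)"
    by (intro member_le_sum) (auto intro: mult_nonneg_nonneg truncation_defect_nonneg nonneg)
  then show ?thesis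
    using truncation_defect_recursion[of N n j] mult_pos_pos[OF assms] by linarith
qed

text \<open>The walk that climbs from \<open>0\<close> to \<open>N + 1\<close> and descends to \<open>j\<close>, one unit at each step.\<close>

lemma truncation_defect_eventually_pos:
  assumes super: "\<And>i. 0 < T i (i + 1)" and sub: "\<And>i. 0 < T (i + 1) i" and "j \<le> N"
  shows "\<exists>n. 0 < truncation_defect T N n j"
proof -
  have up: "0 < si_power T n 0 n" for n
  proof (induction n)
    case 0
    show ?case by (simp add: si_one_def)
  next
    case (Suc n)
    have "si_power T (Suc n) 0 (Suc n) = (\<Sum>i\<le>n. si_power T n 0 i * T i (Suc n))"
      by (rule si_power_row_Suc[OF hess]) auto
    also have "\<dots> = (\<Sum>i\<in>{n}. si_power T n 0 i * T i (Suc n))"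
      by (intro sum.mono_neutral_right) (auto simp: hess)
    finally show ?case using Suc super[of n] by (simp del: si_power.simps)
  qed
  have "0 < truncation_defect T N (N + 1 + r) (N + 1 - r)" if "r \<le> N + 1" for r
    using that
  proof (induction r)
    case 0
    show ?case using up[of "N + 1"] by (simp add: truncation_defect_def del: si_power.simps)
  next
    case (Suc r)
    have "0 < T (N + 1 - r) (N + 1 - Suc r)"
      using sub[of "N - r"] Suc.prems by (simp add: Suc_diff_le)
    with Suc show ?case
      using truncation_defect_propagates[of N "N + 1 + r" "N + 1 - r" "N + 1 - Suc r"] by simp
  qed
  from this[of "N + 1 - j"] show ?thesis using \<open>j \<le> N\<close> by auto
qed

end

lemma moment_inf_eq_sum:
  assumes "p \<le> N + 1"
  shows "moment_inf p T \<nu> a n = (\<Sum>j\<le>N. si_power T n 0 j * e_nu p \<nu> a j)"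
  unfolding moment_inf_def using assms
  by (intro sum.mono_neutral_left) (auto simp: e_nu_def split: if_splits)

lemma remainder_eq_sum_defect:
  assumes "p \<le> N + 1"
  shows "moment_inf p T \<nu> a n - moment_trunc p T \<nu> N a n
    = (\<Sum>j\<le>N. truncation_defect T N n j * e_nu p \<nu> a j)"
  unfolding moment_inf_eq_sum[OF assms] moment_trunc_eq_sum sum_subtractf[symmetric]
  by (intro sum.cong) (auto simp: truncation_defect_def algebra_simps)

text \<open>Once the remainder is positive it stays positive, so the degree of precision, which is where
  the initial run of zero remainders ends, separates the zero remainders from the positive ones.
  The existence of a positive remainder is what makes the greatest element exist.\<close>

lemma degree_of_precision_split:
  assumes zero: "moment_inf p T \<nu> a 0 = moment_trunc p T \<nu> N a 0"
    and le: "\<And>n. moment_trunc p T \<nu> N a n \<le> moment_inf p T \<nu> a n"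
    and up: "\<And>n. moment_trunc p T \<nu> N a n < moment_inf p T \<nu> a n \<Longrightarrow>
      moment_trunc p T \<nu> N a (Suc n) < moment_inf p T \<nu> a (Suc n)"
    and ex: "\<exists>n. moment_trunc p T \<nu> N a n < moment_inf p T \<nu> a n"
  shows "n \<le> degree_of_precision p T \<nu> N a \<Longrightarrow> moment_inf p T \<nu> a n = moment_trunc p T \<nu> N a n"
    and "n > degree_of_precision p T \<nu> N a \<Longrightarrow> moment_trunc p T \<nu> N a n < moment_inf p T \<nu> a n"
proof -
  let ?P = "\<lambda>d. \<forall>n\<le>d. moment_inf p T \<nu> a n = moment_trunc p T \<nu> N a n"
  let ?D = "degree_of_precision p T \<nu> N a"
  obtain b where b: "moment_trunc p T \<nu> N a b < moment_inf p T \<nu> a b" using ex by blast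
  have bound: "d \<le> b" if "?P d" for d
  proof (rule ccontr)
    assume "\<not> d \<le> b"
    then show False using that b by simp
  qed
  have "?P 0" using zero by simp
  then have D: "?P ?D"
    unfolding degree_of_precision_def by (rule GreatestI_nat[where P = ?P and k = 0 and b = b]) (rule bound)
  show "n \<le> ?D \<Longrightarrow> moment_inf p T \<nu> a n = moment_trunc p T \<nu> N a n" using D by blast
  have "\<not> ?P (Suc ?D)"
  proof
    assume "?P (Suc ?D)"
    then have "Suc ?D \<le> (GREATEST d. ?P d)"
      by (rule Greatest_le_nat[where P = ?P and b = b]) (rule bound)
    then have "Suc ?D \<le> ?D"
      by (simp only: degree_of_precision_def)
    then show False by simp
  qed
  then have "moment_inf p T \<nu> a (Suc ?D) \<noteq> moment_trunc p T \<nu> N a (Suc ?D)"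
    using D by (auto simp: le_Suc_eq)
  then have first: "moment_trunc p T \<nu> N a (Suc ?D) < moment_inf p T \<nu> a (Suc ?D)"
    using le[of "Suc ?D"] by simp
  show "moment_trunc p T \<nu> N a n < moment_inf p T \<nu> a n" if "n > ?D"
  proof -
    have "Suc ?D \<le> n" using that by simp
    then show ?thesis by (induction n rule: dec_induct) (use first up in auto)
  qed
qed

lemma script_L_nonneg:
  assumes pos: "\<forall>i\<ge>1. \<alpha> i > 0" and "i < p" "j < p"
  shows "0 \<le> script_L p \<alpha> $$ (i, j)"
proof -
  define F where "F ks = foldr (\<lambda>i v. si_trunc (L_factor p \<alpha> i) (p - 1) *\<^sub>v v) ks (unit_vec p 0)" for ks
  have F: "F ks \<in> carrier_vec p \<and> (\<forall>i<p. 0 \<le> F ks $ i)" for ks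
  proof (induction ks)
    case Nil
    show ?case by (simp add: F_def unit_vec_def)
  next
    case (Cons k ks)
    let ?L = "si_trunc (L_factor p \<alpha> k) (p - 1)"
    have L: "?L \<in> carrier_mat p p" using \<open>i < p\<close> by (simp add: si_trunc_def)
    have "0 \<le> L_factor p \<alpha> k i l" for i l
      using pos by (auto simp: L_factor_def less_imp_le)
    then have "0 \<le> ?L $$ (i, l)" if "i < p" "l < p" for i l
      using that by (simp add: si_trunc_def)
    then have "0 \<le> (?L *\<^sub>v F ks) $ i" if "i < p" for i
      using L Cons.IH that
      by (auto simp: scalar_prod_def intro!: sum_nonneg mult_nonneg_nonneg)
    moreover have "?L *\<^sub>v F ks \<in> carrier_vec p"
      using L Cons.IH by (intro mult_mat_vec_carrier) auto
    ultimately show ?case by (simp add: F_def)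
  qed
  have "0 \<le> script_d p \<alpha> (j + 1)"
    using pos by (auto simp: script_d_def less_imp_le intro!: prod_nonneg)
  moreover have "script_L p \<alpha> $$ (i, j) = script_L_col p \<alpha> (j + 1) $ i"
    using \<open>i < p\<close> \<open>j < p\<close> by (simp add: script_L_def mat_of_cols_index del: upt_Suc)
  moreover have "dim_vec (F [1..<j + 1]) = p"
    using F by (simp only: carrier_vecD)
  then have "script_L_col p \<alpha> (j + 1) $ i = (1 / script_d p \<alpha> (j + 1)) * F [1..<j + 1] $ i"
    unfolding script_L_col_def F_def[symmetric] using \<open>i < p\<close> by (simp only: index_smult_vec)
  moreover have "0 \<le> F [1..<j + 1] $ i"
    using F \<open>i < p\<close> by blast
  ultimately show ?thesis by (simp only: zero_le_mult_iff zero_le_divide_1_iff) blast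
qed

section \<open>The Gauss quadrature formulas\<close>

text \<open>What the interlacing argument is for: the nodes form \<open>N + 1\<close> distinct zeros, so that the list
  of zeros defining them has full length.\<close>

lemma zeroB_zeros:
  assumes "p \<ge> 1" "banded_monic_hessenberg p T" "positive_bidiagonal_factorization p \<alpha> T"
  shows "inj_on (zeroB p T N) {1..N + 1}"
    and "k \<in> {1..N + 1} \<Longrightarrow> poly (typeII p T (N + 1)) (zeroB p T N k) = 0"
proof -
  define f where "f = typeII p T (N + 1)"
  have pos: "\<forall>i\<ge>1. \<alpha> i > 0"
    using assms(3) by (simp add: positive_bidiagonal_factorization_def)
  have f: "pos_simple_zeros f"
    unfolding f_def typeII_eq_chain[OF assms(3,2)] using chain_interlaced[OF pos assms(1)] by blast
  have d: "degree f = N + 1" unfolding f_def using typeII_degree_monic by blast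
  have z: "zeroB p T N k = desc_zero f (k - 1)" for k
    by (simp only: zeroB_def desc_zero_def f_def)
  show "inj_on (zeroB p T N) {1..N + 1}"
  proof (rule linorder_inj_onI)
    fix k l assume "k < l" "k \<in> {1..N + 1}" "l \<in> {1..N + 1}"
    then have "k - 1 < l - 1" "l - 1 < degree f" using d by auto
    then have "desc_zero f (l - 1) < desc_zero f (k - 1)"
      using f unfolding pos_simple_zeros_def by blast
    then show "zeroB p T N k \<noteq> zeroB p T N l" by (simp add: z)
  qed auto
  show "poly (typeII p T (N + 1)) (zeroB p T N k) = 0" if "k \<in> {1..N + 1}"
  proof -
    have "k - 1 < degree f" using that d by auto
    from desc_zero_is_zero[OF f this] show ?thesis by (simp only: z f_def)
  qed
qed

theorem theorem7:
  fixes p N :: nat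
    and T :: si_matrix
    and \<alpha> :: "nat \<Rightarrow> real"
    and \<nu> C :: "real mat"
    and \<psi> :: "nat \<Rightarrow> real \<Rightarrow> real"
  assumes "p \<ge> 1"
    and "banded_monic_hessenberg p T"
    and "si_bounded T"
    and "positive_bidiagonal_factorization p \<alpha> T"
    and "\<nu> \<in> carrier_mat p p" and "lower_unitriangular \<nu>"
    and "C \<in> carrier_mat p p" and "upper_unitriangular C"
    and "\<forall>i<p. \<forall>j<p. C $$ (i, j) \<ge> 0"
    and "transpose_mat (mat_inv \<nu>) = script_L p \<alpha> * C"
    and "spectral_measures p T \<nu> \<psi>"
    and "N \<ge> p - 1"
  shows "\<forall>a\<in>{1..p}.
     (\<forall>n\<le>degree_of_precision p T \<nu> N a.
        (LINT x:Delta p T|interval_measure (\<psi> a). x ^ n)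
          = (\<Sum>k=1..N + 1. christoffel_number p T \<nu> N k a * zeroB p T N k ^ n)) \<and>
     (\<forall>n>degree_of_precision p T \<nu> N a.
        (LINT x:Delta p T|interval_measure (\<psi> a). x ^ n)
          - (\<Sum>k=1..N + 1. christoffel_number p T \<nu> N k a * zeroB p T N k ^ n) > 0)"
proof
  fix a assume a: "a \<in> {1..p}"
  note p = assms(1) and banded = assms(2) and fact = assms(4) and \<nu> = assms(5)
  note inv = lower_unitriangular_inverse[OF assms(5,6)]
  have pN: "p \<le> N + 1" using assms(12) by simp
  have pos: "\<forall>i\<ge>1. \<alpha> i > 0"
    using fact by (simp add: positive_bidiagonal_factorization_def)
  note T_nonneg = factorization_nonneg[OF fact]
    and T_hess = factorization_hessenberg[OF fact]
  have integral: "(LINT x:Delta p T|interval_measure (\<psi> a). x ^ n) = moment_inf p T \<nu> a n" for n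
    by (rule moment_inf_eq_integral[OF banded inv \<nu> assms(11) a])
  have quadrature: "(\<Sum>k=1..N + 1. christoffel_number p T \<nu> N k a * zeroB p T N k ^ n)
      = moment_trunc p T \<nu> N a n" for n
    using zeroB_zeros[OF p banded fact] inv(1) a assms(12) banded
    by (intro quadrature_sum_eq_moment_trunc) auto
  have e_nonneg: "0 \<le> e_nu p \<nu> a i" for i
  proof (cases "i < p")
    case True
    have "e_nu p \<nu> a i = transpose_mat (mat_inv \<nu>) $$ (i, a - 1)"
      using True a inv(1) by (auto simp: e_nu_entry[OF inv(1) a])
    also have "\<dots> = (\<Sum>k<p. script_L p \<alpha> $$ (i, k) * C $$ (k, a - 1))"
      unfolding assms(10)
      using True a by (intro mult_mat_entry[OF _ assms(7)]) (auto simp: script_L_def)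
    also have "\<dots> \<ge> 0"
      using True a assms(9) by (intro sum_nonneg mult_nonneg_nonneg script_L_nonneg[OF pos]) auto
    finally show ?thesis .
  qed (simp add: e_nu_def)
  \<comment> \<open>A row of an invertible matrix does not vanish.\<close>
  obtain i where i: "i < p" "0 < e_nu p \<nu> a i"
  proof (rule ccontr)
    assume "\<not> thesis"
    with that have npos: "\<not> 0 < e_nu p \<nu> a i" if "i < p" for i using that by blast
    have zero: "mat_inv \<nu> $$ (a - 1, i) = 0" if "i < p" for i
    proof -
      have "e_nu p \<nu> a i = 0" using npos[OF that] e_nonneg[of i] by linarith
      then show ?thesis using that by (simp add: e_nu_entry[OF inv(1) a])
    qed
    have a': "a - 1 < p" using a by auto
    have "(mat_inv \<nu> * \<nu>) $$ (a - 1, a - 1) = 0"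
      by (simp only: mult_mat_entry[OF inv(1) \<nu> a' a']) (simp add: zero[simplified])
    then show False using a' by (simp add: inv(2))
  qed
  let ?d = "truncation_defect T N"
  note remainder = remainder_eq_sum_defect[OF pN, of T \<nu> a]
  note d_nonneg = truncation_defect_nonneg[where T = T, OF T_nonneg T_hess]
  have positive: "moment_trunc p T \<nu> N a n < moment_inf p T \<nu> a n"
    if "j \<le> N" "0 < ?d n j" "0 < e_nu p \<nu> a j" for n j
  proof -
    have "0 < (\<Sum>j\<le>N. ?d n j * e_nu p \<nu> a j)"
      using that by (intro sum_pos2[of _ j]) (auto intro: mult_nonneg_nonneg d_nonneg e_nonneg)
    then show ?thesis using remainder[of n] by simp
  qed
  have 0: "moment_inf p T \<nu> a 0 = moment_trunc p T \<nu> N a 0"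
    using remainder[of 0] by (simp add: truncation_defect_0)
  have le: "moment_trunc p T \<nu> N a n \<le> moment_inf p T \<nu> a n" for n
  proof -
    have "0 \<le> (\<Sum>j\<le>N. ?d n j * e_nu p \<nu> a j)"
      by (intro sum_nonneg mult_nonneg_nonneg d_nonneg e_nonneg)
    then show ?thesis using remainder[of n] by simp
  qed
  \<comment> \<open>The positive diagonal of \<open>T\<close> allows a walk to pause at its end point.\<close>
  have up: "moment_trunc p T \<nu> N a (Suc n) < moment_inf p T \<nu> a (Suc n)"
    if "moment_trunc p T \<nu> N a n < moment_inf p T \<nu> a n" for n
  proof -
    have "(\<Sum>j\<le>N. ?d n j * e_nu p \<nu> a j) \<noteq> 0" using remainder[of n] that by simp
    then obtain j where j: "j \<le> N" "?d n j * e_nu p \<nu> a j \<noteq> 0"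
      by (meson atMost_iff sum.neutral)
    then have "0 < ?d n j" "0 < e_nu p \<nu> a j"
      using d_nonneg[of N n j] e_nonneg[of j] by (auto simp: less_le)
    then show ?thesis
      using truncation_defect_propagates[where T = T, OF T_nonneg T_hess _ factorization_diag_pos[OF fact]]
        positive[OF j(1)] by blast
  qed
  have "0 < T j (j + 1)" for j
    using banded by (simp add: banded_monic_hessenberg_def)
  then have "\<exists>n. 0 < ?d n i"
    using i(1) pN
    by (intro truncation_defect_eventually_pos[where T = T, OF T_nonneg T_hess _ factorization_subdiag_pos[OF fact p]])
      auto
  then obtain n where "0 < ?d n i" by blast
  then have ex: "\<exists>n. moment_trunc p T \<nu> N a n < moment_inf p T \<nu> a n"
    using positive[of i n] i pN by auto
  show "(\<forall>n\<le>degree_of_precision p T \<nu> N a.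
        (LINT x:Delta p T|interval_measure (\<psi> a). x ^ n)
          = (\<Sum>k=1..N + 1. christoffel_number p T \<nu> N k a * zeroB p T N k ^ n)) \<and>
     (\<forall>n>degree_of_precision p T \<nu> N a.
        (LINT x:Delta p T|interval_measure (\<psi> a). x ^ n)
          - (\<Sum>k=1..N + 1. christoffel_number p T \<nu> N k a * zeroB p T N k ^ n) > 0)"
    unfolding integral quadrature
    using degree_of_precision_split[OF 0 le up ex] by simp
qed

end
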